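(* Let $H$ be a fixed graph with $e_H\ge 1$. Suppose that there are $G\in\mathcal{L}_H$ and distinct $J_1,\dots,J_r\in\mathcal{L}_H$ (with $r\ge1$), each covering $G$, such that $K:=J_1\cup\cdots\cup J_r$ satisfies $v_K/r<\min_{F\in\mathcal{L}_H}v_F$. Then there are constants $c_H,\beta_H>0$ such that the following holds. (1) For every fixed $\varepsilon>0$ and every $p=p(n)\in[0,1]$ with $1\ll np^{m_H}\ll(\log n)^{c_H}$ we have $$-\log\mathbb{P}\bigl(X_H\ge(1+\varepsilon)\,\mathbb{E}X_H\bigr)=o\Bigl(\min\bigl\{\Phi_H,\;M_H\log(1/p)\bigr\}\Bigr).$$ (2) There is $\lambda=\lambda(n,p,H)$ such that, for every $p=p(n)\in[0,1]$ with $1\ll np^{m_H}\ll n^{\beta_H}$, we have $\lambda\gg1$ and $\lambda\sigma_H\ll\mu_H$, and for every $t=t(n)$ with $\lambda\sigma_H\le t=O(\mu_H)$ we have $$-\log\mathbb{P}\bigl(X_H\ge\mathbb{E}X_H+t\bigr)=o\bigl(t^2/\sigma_H^2\bigr).$$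
   Context: All graphs are finite and simple; $v_G$, $e_G$, $\Delta_G$ denote the number of vertices, the number of edges and the maximum degree of $G$. $G_{n,p}$ is the binomial random graph on vertex set $[n]$. For a fixed graph $G$, $X_G=X_G(n,p)$ is the number of copies of $G$ in $G_{n,p}$, i.e. of (not necessarily induced) subgraphs of $G_{n,p}$ isomorphic to $G$; $\mu_G=\mathbb{E}X_G$ and $\sigma_G^2=\operatorname{Var}X_G$. Set $m_H:=\max_{F\subseteq H:\,v_F\ge1}e_F/v_F$ and $$\Phi_H=\Phi_H(n,p):=\min_{G\subseteq H:\, e_G\ge 1}\mu_G,\qquad M_H=M_H(n,p):=\begin{cases}\min_{G\subseteq H:\,e_G\ge1}\mu_G^{1/\alpha^*_G} & \text{if } p<n^{-1/\Delta_H},\\ n^2p^{\Delta_H} & \text{if } p\ge n^{-1/\Delta_H},\end{cases}$$ where $\alpha^*_G$ is the fractional independence number of $G$: the maximum of $\sum_{v\in V(G)}f(v)$ over all $f:V(G)\to[0,1]$ with $f(u)+f(v)\le1$ for every edge $\{u,v\}\in E(G)$. A subgraph $G\subseteq H$ with $v_G\ge1$ is called primal (for $H$) if $e_G/v_G=m_H$. Every primal subgraph is an induced subgraph of $H$, so primal subgraphs may be identified with their vertex sets; $\mathcal{L}_H$ denotes the family of all primal subgraphs of $H$. For $G_1,G_2\in\mathcal{L}_H$, $G_2$ covers $G_1$ if $G_1\subsetneq G_2$ and there is no primal $F$ with $G_1\subsetneq F\subsetneq G_2$. Asymptotics are as $n\to\infty$, and $a\ll b$ (equivalently $b\gg a$)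 means $a=o(b)$. *)

theory Defs
  imports "HOL-Probability.Probability" "HOL-Probability.Product_PMF" "HOL-Library.Landau_Symbols"
begin

section \<open>Finite simple graphs\<close>

type_synonym 'a ugraph = "'a set \<times> 'a set set"

abbreviation verts :: "'a ugraph \<Rightarrow> 'a set" where
  "verts G \<equiv> fst G"

abbreviation edges :: "'a ugraph \<Rightarrow> 'a set set" where
  "edges G \<equiv> snd G"

definition simple_graph :: "'a ugraph \<Rightarrow> bool" where
  "simple_graph G \<longleftrightarrow> finite (verts G) \<and> edges G \<subseteq> {e. e \<subseteq> verts G \<and> card e = 2}"

abbreviation nverts :: "'a ugraph \<Rightarrow> nat" where
  "nverts G \<equiv> card (verts G)"

abbreviation nedges :: "'a ugraph \<Rightarrow> nat" where
  "nedges G \<equiv> card (edges G)"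

definition vertex_degree :: "'a ugraph \<Rightarrow> 'a \<Rightarrow> nat" where
  "vertex_degree G v = card {e \<in> edges G. v \<in> e}"

definition max_degree :: "'a ugraph \<Rightarrow> nat" where
  "max_degree G = Max (vertex_degree G ` verts G)"

definition subgraph :: "'a ugraph \<Rightarrow> 'a ugraph \<Rightarrow> bool" where
  "subgraph F G \<longleftrightarrow> simple_graph F \<and> verts F \<subseteq> verts G \<and> edges F \<subseteq> edges G"

definition proper_subgraph :: "'a ugraph \<Rightarrow> 'a ugraph \<Rightarrow> bool" where
  "proper_subgraph F G \<longleftrightarrow> subgraph F G \<and> F \<noteq> G"

definition graph_Union :: "'a ugraph set \<Rightarrow> 'a ugraph" where
  "graph_Union \<G> = (\<Union>G\<in>\<G>. verts G, \<Union>G\<in>\<G>. edges G)"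

definition isomorphic :: "'a ugraph \<Rightarrow> 'b ugraph \<Rightarrow> bool" where
  "isomorphic G F \<longleftrightarrow>
     (\<exists>f. bij_betw f (verts G) (verts F) \<and> edges F = (\<lambda>e. f ` e) ` edges G)"

definition num_copies :: "'a ugraph \<Rightarrow> 'b ugraph \<Rightarrow> nat" where
  "num_copies G W = card {F. subgraph F W \<and> isomorphic G F}"

text \<open>The feasible set is compact and nonempty, so the supremum is a maximum.\<close>

definition frac_indep_number :: "'a ugraph \<Rightarrow> real" where
  "frac_indep_number G =
     Sup {(\<Sum>v\<in>verts G. f v) | f :: 'a \<Rightarrow> real.
            (\<forall>v\<in>verts G. f v \<in> {0..1}) \<and> (\<forall>u v. {u, v} \<in> edges G \<longrightarrow> f u + f v \<le> 1)}"

section \<open>Primal subgraphs\<close>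

definition graph_density :: "'a ugraph \<Rightarrow> real" where
  "graph_density G = real (nedges G) / real (nverts G)"

definition max_density :: "'a ugraph \<Rightarrow> real" where
  "max_density H = Max (graph_density ` {F. subgraph F H \<and> nverts F \<ge> 1})"

definition primal :: "'a ugraph \<Rightarrow> 'a ugraph set" where
  "primal H = {G. subgraph G H \<and> nverts G \<ge> 1 \<and> graph_density G = max_density H}"

definition covers :: "'a ugraph \<Rightarrow> 'a ugraph \<Rightarrow> 'a ugraph \<Rightarrow> bool" where
  "covers H G2 G1 \<longleftrightarrow> proper_subgraph G1 G2 \<and>
     \<not> (\<exists>F\<in>primal H. proper_subgraph G1 F \<and> proper_subgraph F G2)"

section \<open>The binomial random graph and subgraph counts\<close>

definition complete_edges :: "nat \<Rightarrow> nat set set" where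
  "complete_edges n = {e. e \<subseteq> {1..n} \<and> card e = 2}"

definition Gnp :: "nat \<Rightarrow> real \<Rightarrow> nat ugraph pmf" where
  "Gnp n p = map_pmf (\<lambda>f. ({1..n}, {e \<in> complete_edges n. f e}))
               (Pi_pmf (complete_edges n) False (\<lambda>_. bernoulli_pmf p))"

definition mu_copies :: "'a ugraph \<Rightarrow> nat \<Rightarrow> real \<Rightarrow> real" where
  "mu_copies G n p = measure_pmf.expectation (Gnp n p) (\<lambda>W. real (num_copies G W))"

definition sigma_copies :: "'a ugraph \<Rightarrow> nat \<Rightarrow> real \<Rightarrow> real" where
  "sigma_copies G n p = sqrt (measure_pmf.variance (Gnp n p) (\<lambda>W. real (num_copies G W)))"

definition upper_tail :: "'a ugraph \<Rightarrow> nat \<Rightarrow> real \<Rightarrow> real \<Rightarrow> real" where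
  "upper_tail G n p x = measure_pmf.prob (Gnp n p) {W. real (num_copies G W) \<ge> x}"

definition Phi_min :: "'a ugraph \<Rightarrow> nat \<Rightarrow> real \<Rightarrow> real" where
  "Phi_min H n p = Min ((\<lambda>G. mu_copies G n p) ` {G. subgraph G H \<and> nedges G \<ge> 1})"

definition M_tail :: "'a ugraph \<Rightarrow> nat \<Rightarrow> real \<Rightarrow> real" where
  "M_tail H n p =
     (if p < real n powr (- 1 / real (max_degree H))
      then Min ((\<lambda>G. mu_copies G n p powr (1 / frac_indep_number G)) ` {G. subgraph G H \<and> nedges G \<ge> 1})
      else real n ^ 2 * p ^ max_degree H)"

text \<open>
  The asymptotic relation \<open>- log (q n) = o(g n)\<close> for probabilities \<open>q n\<close>. Since \<open>ln 0 = 0\<close> in HOL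
  while \<open>- log 0\<close> is infinite, \<open>q n\<close> must explicitly be required to be positive for large \<open>n\<close>.
\<close>

definition neg_log_smallo :: "(nat \<Rightarrow> real) \<Rightarrow> (nat \<Rightarrow> real) \<Rightarrow> bool" where
  "neg_log_smallo q g \<longleftrightarrow> (\<forall>\<^sub>F n in sequentially. q n > 0) \<and> (\<lambda>n. - ln (q n)) \<in> o(g)"

end

theory Submission
  imports Defs "HOL-Real_Asymp.Real_Asymp"
begin

text \<open>
  Write \<open>\<omega> = n p^m\<close> with \<open>m = m_H\<close>. A primal subgraph on \<open>v\<close> vertices has expected count of order
  \<open>\<omega>^v\<close>, and \<open>\<Phi>_H\<close> is of order \<open>\<omega>^k\<close> with \<open>k\<close> the least order of a primal subgraph. Plant a
  blow-up of \<open>K\<close>: one copy of \<open>G\<close>, and \<open>z\<close> disjoint copies of each \<open>J_i - G\<close> attached to it. As distinct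
  covers of \<open>G\<close> meet exactly in \<open>G\<close>, it contains \<open>z^r\<close> copies of \<open>K\<close>, so \<open>z\<close> of order
  \<open>\<omega>^(v_K/r)\<close> is enough to multiply the number of copies of \<open>H\<close> by any constant. No subgraph of the
  blow-up has density above \<open>m\<close>, so by the second moment method it occurs with probability
  \<open>exp (- O(z log z))\<close>, whose exponent is negligible against \<open>\<omega>^k\<close> because \<open>v_K/r < k\<close>.
\<close>

section \<open>Edge events of the binomial random graph\<close>

text \<open>Two second moments are nested: one over the extensions of a fixed planted copy to copies
  of \<open>H\<close>, one over the planted copies. Both rest on \<open>G\<close> and
  \<open>K\<close> being tight, that is, of density m. Relative to a tight set, s further vertices
  of \<open>H\<close> carry at most m s further edges, so each vertex on which two embeddings agree
  costs at most a factor p^(-m). If every vertex ranges over a block of size s, the loss is a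
  product of factors 1 + p^(-m)/s. For the extensions s has order n and the loss is bounded. For the
  planted graph s has order n/z, and O(z) factors of size O(z) give the cost z log z.

  The ranges of p have separate causes. A bound \<omega> \<le> n^\<beta> lets the planted graph fit
  into [n] and keeps the expected counts of non-primal subgraphs at order at least \<omega>^k. The
  power of log n in (1) keeps the cost below sqrt(log n), because M_H log(1/p) is only bounded below
  by a multiple of log n. In (2) the variance is O(\<mu>^2/\<omega>^k), so t^2/\<sigma>^2 exceeds
  the cost even when t is below \<mu> by a small power of \<omega>.\<close>

abbreviation edges_on :: "'a ugraph \<Rightarrow> 'a set \<Rightarrow> 'a set set" where
  "edges_on H S \<equiv> {e \<in> edges H. e \<subseteq> S}"

definition complete_graph :: "nat \<Rightarrow> nat ugraph" where
  "complete_graph n = ({1..n}, complete_edges n)"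

lemma finite_complete_edges [simp]: "finite (complete_edges n)"
  by (simp add: complete_edges_def)

lemma finite_set_Gnp: "finite (set_pmf (Gnp n p))"
proof -
  have "finite (PiE_dflt (complete_edges n) False (\<lambda>_. UNIV :: bool set))"
    by (intro finite_PiE_dflt) auto
  moreover have "set_pmf (Pi_pmf (complete_edges n) False (\<lambda>_. bernoulli_pmf p))
      \<subseteq> PiE_dflt (complete_edges n) False (\<lambda>_. UNIV)"
    using set_Pi_pmf_subset'[of "complete_edges n" False "\<lambda>_. bernoulli_pmf p"]
    by (auto simp: PiE_dflt_def)
  ultimately show ?thesis
    unfolding Gnp_def by (auto intro: finite_subset)
qed

lemma set_Gnp: "W \<in> set_pmf (Gnp n p) \<Longrightarrow> verts W = {1..n} \<and> edges W \<subseteq> complete_edges n"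
  by (auto simp: Gnp_def)

lemma integrable_Gnp [simp]:
  fixes f :: "_ \<Rightarrow> real"
  shows "integrable (measure_pmf (Gnp n p)) f"
  by (intro integrable_measure_pmf_finite finite_set_Gnp)

lemma prob_Gnp_edges:
  assumes "D \<subseteq> complete_edges n" "p \<in> {0..1}"
  shows "measure_pmf.prob (Gnp n p) {W. D \<subseteq> edges W} = p ^ card D"
proof -
  let ?P = "Pi_pmf (complete_edges n) False (\<lambda>_. bernoulli_pmf p)"
  define B where "B = (\<lambda>e. if e \<in> D then {True} else UNIV :: bool set)"
  have "measure_pmf.prob (Gnp n p) {W. D \<subseteq> edges W} = measure_pmf.prob ?P {f. \<forall>e\<in>D. f e}"
    using assms(1) unfolding Gnp_def by (auto intro!: arg_cong2[where f=measure_pmf.prob])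
  \<comment> \<open>The two events differ only in functions that are not \<open>False\<close> off
    \<open>complete_edges n\<close>, and those have probability 0.\<close>
  also have "\<dots> = measure_pmf.prob ?P (PiE_dflt (complete_edges n) False B)"
    using set_Pi_pmf_subset'[of "complete_edges n" False "\<lambda>_. bernoulli_pmf p"] assms(1)
    by (intro measure_eq_AE) (auto simp: AE_measure_pmf_iff PiE_dflt_def B_def split: if_splits)
  also have "\<dots> = (\<Prod>e\<in>complete_edges n. measure_pmf.prob (bernoulli_pmf p) (B e))"
    by (simp add: measure_Pi_pmf_PiE_dflt)
  also have "\<dots> = (\<Prod>e\<in>complete_edges n. if e \<in> D then p else 1)"
    using assms(2) by (intro prod.cong) (auto simp: B_def measure_pmf_single)
  also have "\<dots> = (\<Prod>e\<in>D. p)"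
    using assms(1) by (subst prod.inter_restrict[symmetric]) (auto simp: Int_absorb1)
  finally show ?thesis by simp
qed

lemma expectation_Gnp_edges:
  assumes "D \<subseteq> complete_edges n" "p \<in> {0..1}"
  shows "measure_pmf.expectation (Gnp n p) (\<lambda>W. of_bool (D \<subseteq> edges W)) = p ^ card D"
proof -
  have "(\<lambda>W. of_bool (D \<subseteq> edges W) :: real) = indicator {W::nat ugraph. D \<subseteq> edges W}"
    by (auto simp: fun_eq_iff)
  then show ?thesis
    using prob_Gnp_edges[OF assms] by simp
qed

text \<open>The support is finite, so this is the inequality for finite sums with each weight split
  as the square of its root.\<close>

lemma Cauchy_Schwarz_Gnp:
  fixes f g :: "nat ugraph \<Rightarrow> real"
  shows "(measure_pmf.expectation (Gnp n p) (\<lambda>W. f W * g W))\<^sup>2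
    \<le> measure_pmf.expectation (Gnp n p) (\<lambda>W. (f W)\<^sup>2)
      * measure_pmf.expectation (Gnp n p) (\<lambda>W. (g W)\<^sup>2)"
proof -
  let ?S = "set_pmf (Gnp n p)"
  have E: "measure_pmf.expectation (Gnp n p) h = (\<Sum>W\<in>?S. pmf (Gnp n p) W * h W)" for h :: "_ \<Rightarrow> real"
    by (subst integral_measure_pmf_real[OF finite_set_Gnp]) (auto simp: mult.commute)
  have sq: "sqrt (pmf (Gnp n p) W) * sqrt (pmf (Gnp n p) W) = pmf (Gnp n p) W" for W
    by simp
  have "(\<Sum>W\<in>?S. (sqrt (pmf (Gnp n p) W) * f W) * (sqrt (pmf (Gnp n p) W) * g W))\<^sup>2
      \<le> (\<Sum>W\<in>?S. (sqrt (pmf (Gnp n p) W) * f W)\<^sup>2) * (\<Sum>W\<in>?S. (sqrt (pmf (Gnp n p) W) * g W)\<^sup>2)"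
    by (rule Cauchy_Schwarz_ineq_sum)
  moreover have "(sqrt (pmf (Gnp n p) W) * f W) * (sqrt (pmf (Gnp n p) W) * g W)
      = pmf (Gnp n p) W * (f W * g W)" for W
    using sq[of W] by (metis (no_types, opaque_lifting) mult.assoc mult.left_commute)
  ultimately show ?thesis
    unfolding E by (simp add: power_mult_distrib)
qed

text \<open>Paley--Zygmund for the conditional law given \<open>A\<close>, cleared of denominators.\<close>

lemma Paley_Zygmund_edges:
  assumes p: "p \<in> {0..1}" and A: "A \<subseteq> complete_edges n"
    and C: "finite C" and D: "\<And>c. c \<in> C \<Longrightarrow> D c \<subseteq> complete_edges n"
    and T: "0 \<le> T" "T * p ^ card A \<le> (\<Sum>c\<in>C. p ^ card (A \<union> D c)) / 2"
  shows "(\<Sum>c\<in>C. p ^ card (A \<union> D c))\<^sup>2 / 4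
    \<le> measure_pmf.prob (Gnp n p) {W. A \<subseteq> edges W \<and> T \<le> real (card {c\<in>C. D c \<subseteq> edges W})}
      * (\<Sum>c\<in>C. \<Sum>c'\<in>C. p ^ card (A \<union> D c \<union> D c'))"
proof -
  let ?E = "measure_pmf.expectation (Gnp n p)"
  define Q where "Q = (\<lambda>W::nat ugraph. real (card {c\<in>C. D c \<subseteq> edges W}))"
  define a where "a = (\<lambda>W::nat ugraph. of_bool (A \<subseteq> edges W) :: real)"
  define b where "b = (\<lambda>W::nat ugraph. of_bool (A \<subseteq> edges W \<and> T \<le> Q W) :: real)"
  have Q: "Q W = (\<Sum>c\<in>C. of_bool (D c \<subseteq> edges W))" for W
    using C by (simp add: Q_def sum_of_bool_eq Int_def)
  have "?E (\<lambda>W. a W * Q W) = ?E (\<lambda>W. \<Sum>c\<in>C. of_bool (A \<union> D c \<subseteq> edges W))"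
    unfolding Q a_def sum_distrib_left by (intro Bochner_Integration.integral_cong refl sum.cong) auto
  also have "\<dots> = (\<Sum>c\<in>C. p ^ card (A \<union> D c))"
    using A D p by (auto simp: Bochner_Integration.integral_sum simp del: sup.bounded_iff
      intro!: sum.cong expectation_Gnp_edges)
  finally have 1: "?E (\<lambda>W. a W * Q W) = (\<Sum>c\<in>C. p ^ card (A \<union> D c))" .
  have "?E (\<lambda>W. (a W * Q W)\<^sup>2) = ?E (\<lambda>W. \<Sum>c\<in>C. \<Sum>c'\<in>C. of_bool (A \<union> D c \<union> D c' \<subseteq> edges W))"
    unfolding Q a_def sum_distrib_left power2_eq_square sum_product
    by (intro Bochner_Integration.integral_cong refl sum.cong) auto
  also have "\<dots> = (\<Sum>c\<in>C. \<Sum>c'\<in>C. p ^ card (A \<union> D c \<union> D c'))"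
    using A D p by (auto simp: Bochner_Integration.integral_sum simp del: sup.bounded_iff
      intro!: sum.cong expectation_Gnp_edges)
  finally have 2: "?E (\<lambda>W. (a W * Q W)\<^sup>2) = (\<Sum>c\<in>C. \<Sum>c'\<in>C. p ^ card (A \<union> D c \<union> D c'))" .
  have 3: "?E a = p ^ card A"
    unfolding a_def by (rule expectation_Gnp_edges[OF A p])
  have b: "b = indicator {W. A \<subseteq> edges W \<and> T \<le> Q W}"
    by (auto simp: b_def fun_eq_iff)
  have 4: "?E b = measure_pmf.prob (Gnp n p) {W. A \<subseteq> edges W \<and> T \<le> Q W}"
    unfolding b by simp
  have "?E (\<lambda>W. a W * Q W) - T * ?E a = ?E (\<lambda>W. a W * Q W - T * a W)"
    by simp
  \<comment> \<open>Pointwise: where \<open>a W = 1\<close> and \<open>b W = 0\<close> one has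
    \<open>Q W < T\<close>, so the left side is negative; where both are 1, dropping
    \<open>T\<close> only increases it.\<close>
  also have "\<dots> \<le> ?E (\<lambda>W. b W * (a W * Q W))"
    by (intro integral_mono) (use T(1) in \<open>auto simp: a_def b_def Q_def\<close>)
  finally have "(\<Sum>c\<in>C. p ^ card (A \<union> D c)) / 2 \<le> ?E (\<lambda>W. b W * (a W * Q W))"
    using T(2) unfolding 1 3 by linarith
  moreover have "0 \<le> (\<Sum>c\<in>C. p ^ card (A \<union> D c)) / 2"
    using p by (auto intro!: sum_nonneg)
  ultimately have "((\<Sum>c\<in>C. p ^ card (A \<union> D c)) / 2)\<^sup>2 \<le> (?E (\<lambda>W. b W * (a W * Q W)))\<^sup>2"
    by (intro power_mono)
  also have "\<dots> \<le> ?E (\<lambda>W. (b W)\<^sup>2) * ?E (\<lambda>W. (a W * Q W)\<^sup>2)"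
    by (rule Cauchy_Schwarz_Gnp)
  also have "(\<lambda>W. (b W)\<^sup>2) = b"
    by (auto simp: b_def)
  finally show ?thesis
    unfolding 2 4 by (simp add: power_divide Q_def)
qed

text \<open>Cauchy-Schwarz for the number \<open>Z\<close> of events that occur, as \<open>Z\<close>
  vanishes off their union. The second moment is computed from the larger edge events
  \<open>D c\<close>, so \<open>B c\<close> may be a complicated event, later a planted copy that
  also has many extensions.\<close>

lemma second_moment_Union:
  assumes p: "p \<in> {0..1}" and C: "finite C"
    and D: "\<And>c. c \<in> C \<Longrightarrow> D c \<subseteq> complete_edges n"
    and B: "\<And>c W. c \<in> C \<Longrightarrow> B c W \<Longrightarrow> D c \<subseteq> edges W"
  shows "(\<Sum>c\<in>C. measure_pmf.prob (Gnp n p) {W. B c W})\<^sup>2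
    \<le> measure_pmf.prob (Gnp n p) {W. \<exists>c\<in>C. B c W} * (\<Sum>c\<in>C. \<Sum>c'\<in>C. p ^ card (D c \<union> D c'))"
proof -
  let ?E = "measure_pmf.expectation (Gnp n p)"
  define Z where "Z = (\<lambda>W::nat ugraph. \<Sum>c\<in>C. of_bool (B c W) :: real)"
  define b where "b = (\<lambda>W::nat ugraph. of_bool (\<exists>c\<in>C. B c W) :: real)"
  have ind: "(\<lambda>W. of_bool (P W) :: real) = indicator {W. P W}" for P :: "nat ugraph \<Rightarrow> bool"
    by (auto simp: fun_eq_iff)
  have "?E Z = (\<Sum>c\<in>C. ?E (\<lambda>W. of_bool (B c W)))"
    unfolding Z_def by (rule Bochner_Integration.integral_sum) auto
  then have 1: "?E Z = (\<Sum>c\<in>C. measure_pmf.prob (Gnp n p) {W. B c W})"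
    by (simp add: ind)
  have "?E (\<lambda>W. (Z W)\<^sup>2) \<le> ?E (\<lambda>W. \<Sum>c\<in>C. \<Sum>c'\<in>C. of_bool (D c \<union> D c' \<subseteq> edges W))"
    unfolding Z_def power2_eq_square sum_product
    by (intro integral_mono sum_mono) (use B in \<open>auto simp: of_bool_def\<close>)
  also have "\<dots> = (\<Sum>c\<in>C. \<Sum>c'\<in>C. p ^ card (D c \<union> D c'))"
    using D p by (auto simp: Bochner_Integration.integral_sum simp del: sup.bounded_iff
      intro!: sum.cong expectation_Gnp_edges)
  finally have 2: "?E (\<lambda>W. (Z W)\<^sup>2) \<le> (\<Sum>c\<in>C. \<Sum>c'\<in>C. p ^ card (D c \<union> D c'))" .
  have 3: "?E b = measure_pmf.prob (Gnp n p) {W. \<exists>c\<in>C. B c W}"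
    unfolding b_def ind by simp
  have "Z = (\<lambda>W. b W * Z W)" "(\<lambda>W. (b W)\<^sup>2) = b"
    by (auto simp: b_def Z_def fun_eq_iff intro!: sum.neutral)
  then have "(?E Z)\<^sup>2 \<le> ?E b * ?E (\<lambda>W. (Z W)\<^sup>2)"
    using Cauchy_Schwarz_Gnp[of n p b Z] by simp
  also have "\<dots> \<le> ?E b * (\<Sum>c\<in>C. \<Sum>c'\<in>C. p ^ card (D c \<union> D c'))"
    using 2 by (intro mult_left_mono) (auto simp: 3)
  finally show ?thesis
    unfolding 1 3 .
qed

section \<open>Overlapping pairs of embeddings\<close>

text \<open>For fixed \<open>f\<close> the sum over \<open>g\<close> factorises over the
  coordinates. Coordinate \<open>x\<close> contributes a + |B x| - 1, which is at most |B x| (1 +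
  a/s) because |B x| \<ge> s.\<close>

lemma sum_pairs_PiE:
  fixes a :: real
  assumes X: "finite X" "\<And>x. x \<in> X \<Longrightarrow> finite (B x)" "\<And>x. x \<in> X \<Longrightarrow> s \<le> card (B x)"
    and "0 < s" "0 \<le> a"
  shows "(\<Sum>f\<in>PiE X B. \<Sum>g\<in>PiE X B. \<Prod>x\<in>X. if f x = g x then a else 1)
    \<le> (real (card (PiE X B)))\<^sup>2 * (1 + a / real s) ^ card X"
proof -
  have *: "(\<Sum>g\<in>PiE X B. \<Prod>x\<in>X. if f x = g x then a else 1) \<le> real (card (PiE X B)) * (1 + a / real s) ^ card X"
    if "f \<in> PiE X B" for f
  proof -
    have "(\<Sum>g\<in>PiE X B. \<Prod>x\<in>X. if f x = g x then a else 1) = (\<Prod>x\<in>X. \<Sum>v\<in>B x. if f x = v then a else 1)"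
      using X by (subst prod_sum_PiE) auto
    also have "\<dots> \<le> (\<Prod>x\<in>X. real (card (B x)) * (1 + a / real s))"
    proof (intro prod_mono conjI sum_nonneg)
      fix x assume x: "x \<in> X"
      have fx: "f x \<in> B x" using that x by auto
      have "(\<Sum>v\<in>B x. if f x = v then a else 1) = a + (\<Sum>v\<in>B x - {f x}. 1)"
        using X x fx by (subst sum.remove[of _ "f x"]) (auto intro!: sum.cong simp del: sum_constant split: if_splits)
      also have "\<dots> \<le> a + card (B x)"
        using X(2)[OF x] by (simp add: card_mono)
      also have "a + card (B x) \<le> a * (card (B x) / s) + card (B x)"
        using X(3)[OF x] assms mult_left_mono[of 1 "card (B x) / s" a] by simp
      finally show "(\<Sum>v\<in>B x. if f x = v then a else 1) \<le> real (card (B x)) * (1 + a / real s)"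
        by (simp add: algebra_simps)
    qed (use assms in auto)
    also have "\<dots> = real (card (PiE X B)) * (1 + a / real s) ^ card X"
      using X(1) by (simp add: card_PiE prod.distrib)
    finally show ?thesis .
  qed
  have "(\<Sum>f\<in>PiE X B. \<Sum>g\<in>PiE X B. \<Prod>x\<in>X. if f x = g x then a else 1)
      \<le> (\<Sum>f\<in>PiE X B. real (card (PiE X B)) * (1 + a / real s) ^ card X)"
    by (intro sum_mono *)
  then show ?thesis by (simp add: power2_eq_square mult.assoc)
qed

text \<open>Applying the common left inverse \<open>c\<close> to both images recovers
  \<open>e\<close> and \<open>e'\<close>. In the applications \<open>c\<close> is a colouring of the
  target that reveals which vertex was mapped there.\<close>

lemma image_eq_left_inverse:
  assumes f: "\<And>x. x \<in> V \<Longrightarrow> c (f x) = x" and g: "\<And>x. x \<in> V \<Longrightarrow> c (g x) = x"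
    and e: "e \<subseteq> V" "e' \<subseteq> V" and eq: "f ` e = g ` e'"
  shows "e = e' \<and> (\<forall>x\<in>e. f x = g x)"
proof -
  have "c ` f ` e = e"
    unfolding image_image using f e(1) by (simp add: subset_iff)
  moreover have "c ` g ` e' = e'"
    unfolding image_image using g e(2) by (simp add: subset_iff)
  ultimately have "e = e'" unfolding eq by simp
  moreover have "f x = g x" if x: "x \<in> e" for x
  proof -
    obtain y where y: "y \<in> e'" "f x = g y" using x eq by blast
    have "x = c (f x)" using f e x by auto
    also have "\<dots> = y" unfolding y(2) using g e y(1) by auto
    finally show ?thesis using y(2) by simp
  qed
  ultimately show ?thesis by blast
qed

text \<open>If two embeddings share \<open>k\<close> edges then they agree on a set spanning these \<open>k\<close> edges, whence
  \<open>k \<le> m |S|\<close> for the set \<open>S\<close> of new vertices on which they agree.\<close>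

lemma power_card_Un_images_le:
  fixes m p :: real
  assumes inv: "\<And>x. x \<in> V \<Longrightarrow> c (f x) = x" "\<And>x. x \<in> V \<Longrightarrow> c (g x) = x"
    and E: "finite E" "\<And>e. e \<in> E \<Longrightarrow> e \<subseteq> V"
    and X: "finite X"
    and m: "real (card {e\<in>E. \<forall>x\<in>e. f x = g x}) \<le> m * real (card {x\<in>X. f x = g x})"
    and p: "0 < p" "p \<le> 1"
  shows "p ^ card ((`) f ` E \<union> (`) g ` E)
    \<le> p ^ (2 * card E) * (\<Prod>x\<in>X. if f x = g x then p powr (- m) else 1)"
proof -
  have inj: "inj_on f V" "inj_on g V"
    using inj_on_inverseI[of V c f] inj_on_inverseI[of V c g] inv by auto
  have injE: "inj_on ((`) h) E" if "inj_on h V" for h :: "'a \<Rightarrow> 'b"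
    using inj_on_image_Pow[OF that] E(2) by (auto intro: inj_on_subset)
  have "(`) f ` E \<inter> (`) g ` E \<subseteq> (`) f ` {e\<in>E. \<forall>x\<in>e. f x = g x}"
  proof
    fix d assume "d \<in> (`) f ` E \<inter> (`) g ` E"
    then obtain e e' where e: "e \<in> E" "e' \<in> E" "d = f ` e" "f ` e = g ` e'" by auto
    then have "\<forall>x\<in>e. f x = g x"
      using image_eq_left_inverse[of V c f g e e', OF inv] E(2) by blast
    then show "d \<in> (`) f ` {e\<in>E. \<forall>x\<in>e. f x = g x}" using e by blast
  qed
  then have "card ((`) f ` E \<inter> (`) g ` E) \<le> card {e\<in>E. \<forall>x\<in>e. f x = g x}"
    using E(1) by (intro order_trans[OF card_mono card_image_le]) auto
  moreover have "card ((`) f ` E) = card E" "card ((`) g ` E) = card E"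
    using injE inj by (auto intro: card_image)
  ultimately have "2 * card E \<le> card ((`) f ` E \<union> (`) g ` E) + card {e\<in>E. \<forall>x\<in>e. f x = g x}"
    using card_Un_Int[of "(`) f ` E" "(`) g ` E"] E(1) by simp
  then have "real (card ((`) f ` E \<union> (`) g ` E)) \<ge> real (2 * card E) - m * real (card {x\<in>X. f x = g x})"
    using m by linarith
  then have "p powr real (card ((`) f ` E \<union> (`) g ` E))
      \<le> p powr (real (2 * card E) - m * real (card {x\<in>X. f x = g x}))"
    using p by (intro powr_mono') auto
  also have "\<dots> = p powr real (2 * card E) * (p powr (- m)) powr real (card {x\<in>X. f x = g x})"
    by (simp add: powr_powr powr_add[symmetric])
  also have "(p powr (- m)) powr real (card {x\<in>X. f x = g x}) = (\<Prod>x\<in>X. if f x = g x then p powr (- m) else 1)"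
    using X p by (simp add: powr_realpow prod.If_cases Int_def)
  finally show ?thesis using p by (simp add: powr_realpow del: of_nat_mult)
qed

section \<open>Densities and primal subgraphs\<close>

lemma simple_graph_finite:
  assumes "simple_graph H"
  shows "finite (verts H)" "finite (edges H)"
proof -
  show "finite (verts H)" using assms by (simp add: simple_graph_def)
  then show "finite (edges H)"
    using assms finite_subset[of "edges H" "Pow (verts H)"] by (auto simp: simple_graph_def)
qed

lemma simple_graph_edge:
  assumes "simple_graph H" "e \<in> edges H"
  shows "e \<subseteq> verts H" "card e = 2" "finite e" "e \<noteq> {}"
proof -
  show 1: "e \<subseteq> verts H" "card e = 2" using assms by (auto simp: simple_graph_def)
  then show "finite e" "e \<noteq> {}" using card_ge_0_finite[of e] by auto
qed

lemma finite_subgraphs: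
  assumes "simple_graph H"
  shows "finite {F. subgraph F H}"
proof -
  have "{F. subgraph F H} \<subseteq> Pow (verts H) \<times> Pow (edges H)"
    by (auto simp: subgraph_def)
  then show ?thesis
    using simple_graph_finite[OF assms] by (meson finite_Pow_iff finite_SigmaI finite_subset)
qed

text \<open>Cleared of the denominator, the bound also covers the graph without vertices, which the
  maximum excludes.\<close>

lemma subgraph_density:
  assumes "simple_graph H" "subgraph F H"
  shows "real (nedges F) \<le> max_density H * real (nverts F)"
proof (cases "nverts F \<ge> 1")
  case True
  have "graph_density F \<le> max_density H"
    unfolding max_density_def
    using assms True finite_subgraphs[OF assms(1)] by (intro Max_ge) auto
  then show ?thesis
    using True by (simp add: graph_density_def divide_le_eq)
next
  case False
  have "simple_graph F" using assms by (simp add: subgraph_def)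
  then have "verts F = {}" using False simple_graph_finite(1)[of F] by (simp add: Suc_le_eq card_gt_0_iff)
  then have "edges F = {}"
    using simple_graph_edge(1,4)[OF \<open>simple_graph F\<close>] by blast
  moreover have "nverts F = 0" using False by simp
  ultimately show ?thesis by simp
qed

lemma subgraph_edges_on:
  assumes "simple_graph H" "S \<subseteq> verts H"
  shows "subgraph (S, edges_on H S) H"
  using assms finite_subset[of S "verts H"] by (auto simp: subgraph_def simple_graph_def)

lemma card_edges_on_le:
  assumes "simple_graph H" "S \<subseteq> verts H"
  shows "real (card (edges_on H S)) \<le> max_density H * real (card S)"
  using subgraph_density[OF assms(1) subgraph_edges_on[OF assms]] by simp

lemma primal_iff:
  "F \<in> primal H \<longleftrightarrow> subgraph F H \<and> nverts F \<ge> 1 \<and> real (nedges F) = max_density H * real (nverts F)"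
  by (auto simp: primal_def graph_density_def field_simps)

text \<open>Restoring a missing edge of \<open>H\<close> on the same vertices would push the density
  above the maximum.\<close>

lemma primal_edges:
  assumes "simple_graph H" "F \<in> primal H"
  shows "edges F = edges_on H (verts F)"
proof (rule card_seteq)
  have F: "subgraph F H" "simple_graph F" using assms by (auto simp: primal_iff subgraph_def)
  show "finite (edges_on H (verts F))" using simple_graph_finite[OF assms(1)] by simp
  show "edges F \<subseteq> edges_on H (verts F)"
    using F by (auto simp: subgraph_def simple_graph_def)
  show "card (edges_on H (verts F)) \<le> nedges F"
    using card_edges_on_le[OF assms(1), of "verts F"] F assms(2) by (auto simp: primal_iff subgraph_def)
qed

text \<open>Vertex and edge counts of union and intersection add up to those of \<open>A\<close> and
  \<open>B\<close>. Hence the two deficits m v - e sum to 0, and neither is negative.\<close>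

lemma primal_Un_Int:
  assumes H: "simple_graph H" and A: "A \<in> primal H" and B: "B \<in> primal H"
    and ne: "verts A \<inter> verts B \<noteq> {}"
  shows "(verts A \<union> verts B, edges A \<union> edges B) \<in> primal H"
    and "(verts A \<inter> verts B, edges A \<inter> edges B) \<in> primal H"
proof -
  have AB: "subgraph A H" "subgraph B H" "simple_graph A" "simple_graph B"
    using A B by (auto simp: primal_iff subgraph_def)
  note fin = simple_graph_finite[OF AB(3)] simple_graph_finite[OF AB(4)]
  let ?U = "(verts A \<union> verts B, edges A \<union> edges B)" and ?I = "(verts A \<inter> verts B, edges A \<inter> edges B)"
  have sub: "subgraph ?U H" "subgraph ?I H"
    using AB by (auto simp: subgraph_def simple_graph_def)
  have "real (nedges ?U) + real (nedges ?I) = real (nedges A) + real (nedges B)"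
    using card_Un_Int[of "edges A" "edges B"] fin by simp
  also have "\<dots> = max_density H * (real (nverts A) + real (nverts B))"
    using A B by (simp add: primal_iff algebra_simps)
  also have "real (nverts A) + real (nverts B) = real (nverts ?U) + real (nverts ?I)"
    using card_Un_Int[of "verts A" "verts B"] fin by simp
  finally have "real (nedges ?U) + real (nedges ?I)
    = max_density H * real (nverts ?U) + max_density H * real (nverts ?I)"
    by (simp add: algebra_simps)
  then have "real (nedges ?U) = max_density H * real (nverts ?U)"
    "real (nedges ?I) = max_density H * real (nverts ?I)"
    using subgraph_density[OF H sub(1)] subgraph_density[OF H sub(2)] by linarith+
  moreover have "nverts ?U \<ge> 1" "nverts ?I \<ge> 1"
    using ne fin by (auto simp: Suc_le_eq card_gt_0_iff)
  ultimately show "?U \<in> primal H" "?I \<in> primal H"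
    using sub by (auto simp: primal_iff)
qed

lemma primal_nonempty:
  assumes "simple_graph H" "nedges H \<ge> 1"
  shows "primal H \<noteq> {}" "finite (primal H)"
proof -
  show "finite (primal H)"
    using finite_subgraphs[OF assms(1)] by (rule rev_finite_subset) (auto simp: primal_def)
  let ?S = "{F. subgraph F H \<and> nverts F \<ge> 1}"
  have "verts H \<noteq> {}"
    using assms simple_graph_edge[OF assms(1)] by (metis One_nat_def card.empty ex_in_conv not_one_le_zero subset_empty)
  then have "H \<in> ?S"
    using assms(1) simple_graph_finite[OF assms(1)] by (auto simp: subgraph_def Suc_le_eq card_gt_0_iff)
  moreover have "finite ?S" using finite_subgraphs[OF assms(1)] by simp
  ultimately have "max_density H \<in> graph_density ` ?S"
    unfolding max_density_def by (intro Max_in finite_imageI) (assumption, metis empty_iff image_is_empty)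
  then show "primal H \<noteq> {}" by (force simp: primal_def)
qed

lemma max_density_pos:
  assumes "simple_graph H" "nedges H \<ge> 1"
  shows "max_density H > 0"
proof -
  have "subgraph H H" using assms(1) by (simp add: subgraph_def)
  then have "1 \<le> max_density H * real (nverts H)"
    using subgraph_density[OF assms(1), of H] assms(2) by simp
  then show ?thesis
    by (smt (verit) mult_nonpos_nonneg of_nat_0_le_iff)
qed

section \<open>Counting copies\<close>

text \<open>These are the potential copies. A graph on \<open>{1..n}\<close> contains one iff it
  contains its edges, so the copy count is a sum of edge-event indicators over a fixed finite
  set.\<close>

definition copies :: "'a ugraph \<Rightarrow> nat \<Rightarrow> nat ugraph set" where
  "copies G n = {F. subgraph F (complete_graph n) \<and> isomorphic G F}"

abbreviation maps :: "'a set \<Rightarrow> nat \<Rightarrow> ('a \<Rightarrow> nat) set" where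
  "maps V n \<equiv> PiE V (\<lambda>_. {1..n})"

definition image_graph :: "('a \<Rightarrow> 'b) \<Rightarrow> 'a ugraph \<Rightarrow> 'b ugraph" where
  "image_graph f G = (f ` verts G, (`) f ` edges G)"

lemma simple_complete_graph: "simple_graph (complete_graph n)"
  by (auto simp: simple_graph_def complete_graph_def complete_edges_def)

lemma finite_copies: "finite (copies G n)"
  unfolding copies_def using finite_subgraphs[OF simple_complete_graph] by simp

lemma image_edges_complete:
  assumes "simple_graph G" "inj_on f (verts G)" "f ` verts G \<subseteq> {1..n}"
  shows "(`) f ` edges G \<subseteq> complete_edges n"
proof
  fix d assume "d \<in> (`) f ` edges G"
  then obtain e where e: "e \<in> edges G" "d = f ` e" by auto
  have "card d = 2"
    using e simple_graph_edge[OF assms(1) e(1)] assms(2) by (metis card_image inj_on_subset)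
  then show "d \<in> complete_edges n"
    using e simple_graph_edge[OF assms(1) e(1)] assms(3) by (auto simp: complete_edges_def)
qed

lemma image_graph_copies:
  assumes G: "simple_graph G" and f: "inj_on f (verts G)" "f ` verts G \<subseteq> {1..n}"
  shows "image_graph f G \<in> copies G n"
  unfolding copies_def mem_Collect_eq
proof
  have 1: "(`) f ` edges G \<subseteq> complete_edges n" by (rule image_edges_complete[OF assms])
  have "(`) f ` edges G \<subseteq> {d. d \<subseteq> f ` verts G \<and> card d = 2}"
  proof
    fix d assume d: "d \<in> (`) f ` edges G"
    then have "card d = 2" using 1 unfolding complete_edges_def by blast
    moreover have "d \<subseteq> f ` verts G" using d simple_graph_edge(1)[OF G] by (metis imageE image_mono)
    ultimately show "d \<in> {d. d \<subseteq> f ` verts G \<and> card d = 2}" by simp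
  qed
  moreover have "finite (f ` verts G)" using simple_graph_finite[OF G] by simp
  ultimately show "subgraph (image_graph f G) (complete_graph n)"
    using f(2) 1 by (simp only: subgraph_def simple_graph_def image_graph_def complete_graph_def
      fst_conv snd_conv simp_thms)
  show "isomorphic G (image_graph f G)"
    using f by (auto simp: isomorphic_def image_graph_def bij_betw_def)
qed

text \<open>Restricting an isomorphism to \<open>verts G\<close> makes it an extensional map, so the
  copies are indexed by a finite set of maps. Automorphisms of \<open>G\<close> cause
  repetitions.\<close>

lemma copies_eq:
  assumes G: "simple_graph G"
  shows "copies G n = (\<lambda>f. image_graph f G) ` {f\<in>maps (verts G) n. inj_on f (verts G)}"
proof (intro equalityI subsetI)
  fix F assume F: "F \<in> copies G n"
  then obtain f where f: "bij_betw f (verts G) (verts F)" "edges F = (\<lambda>e. f ` e) ` edges G"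
    by (auto simp: copies_def isomorphic_def)
  define g where "g = restrict f (verts G)"
  have "g \<in> maps (verts G) n" "inj_on g (verts G)"
    using f F by (auto simp: g_def copies_def subgraph_def complete_graph_def bij_betw_def)
  moreover have "g ` e = f ` e" if "e \<subseteq> verts G" for e
    using that by (auto simp: g_def image_iff subset_iff)
  then have "image_graph g G = F"
    using f simple_graph_edge[OF G]
    by (auto simp: image_graph_def bij_betw_def prod_eq_iff image_def)
  ultimately show "F \<in> (\<lambda>f. image_graph f G) ` {f\<in>maps (verts G) n. inj_on f (verts G)}" by blast
next
  fix F assume "F \<in> (\<lambda>f. image_graph f G) ` {f\<in>maps (verts G) n. inj_on f (verts G)}"
  then show "F \<in> copies G n" using image_graph_copies[OF G] by blast
qed

lemma copy_edges:
  assumes G: "simple_graph G" and F: "F \<in> copies G n"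
  shows "edges F \<subseteq> complete_edges n" "card (edges F) = nedges G"
proof -
  show "edges F \<subseteq> complete_edges n"
    using F by (auto simp: copies_def subgraph_def complete_graph_def)
  obtain f where f: "bij_betw f (verts G) (verts F)" "edges F = (`) f ` edges G"
    using F unfolding copies_def isomorphic_def by blast
  have "edges G \<subseteq> Pow (verts G)" using simple_graph_edge(1)[OF G] by blast
  then have "inj_on ((`) f) (edges G)"
    using inj_on_image_Pow[of f "verts G"] f(1) by (auto simp: bij_betw_def intro: inj_on_subset)
  then show "card (edges F) = nedges G" using f by (simp add: card_image)
qed

lemma num_copies_eq_card:
  assumes "verts W = {1..n}" "edges W \<subseteq> complete_edges n"
  shows "num_copies G W = card {F \<in> copies G n. edges F \<subseteq> edges W}"
  unfolding num_copies_def copies_def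
  using assms by (intro arg_cong[where f = card]) (auto simp: subgraph_def complete_graph_def)

lemma num_copies_eq_sum:
  assumes "W \<in> set_pmf (Gnp n p)"
  shows "real (num_copies G W) = (\<Sum>F\<in>copies G n. of_bool (edges F \<subseteq> edges W))"
  using num_copies_eq_card[of W n G] set_Gnp[OF assms] finite_copies[of G n]
  by (simp add: sum_of_bool_eq Int_def)

lemma mu_copies_eq:
  assumes G: "simple_graph G" and p: "p \<in> {0..1}"
  shows "mu_copies G n p = real (card (copies G n)) * p ^ nedges G"
proof -
  have "mu_copies G n p
      = measure_pmf.expectation (Gnp n p) (\<lambda>W. \<Sum>F\<in>copies G n. of_bool (edges F \<subseteq> edges W))"
    unfolding mu_copies_def
    by (intro integral_cong_AE) (auto simp: AE_measure_pmf_iff num_copies_eq_sum)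
  also have "\<dots> = (\<Sum>F\<in>copies G n. p ^ nedges G)"
    using copy_edges[OF G] p
    by (auto simp: Bochner_Integration.integral_sum expectation_Gnp_edges intro!: sum.cong)
  finally show ?thesis by simp
qed

lemma card_maps: "finite V \<Longrightarrow> card (maps V n) = n ^ card V"
  by (simp add: card_PiE)

lemma card_copies_le:
  assumes G: "simple_graph G"
  shows "card (copies G n) \<le> n ^ nverts G"
proof -
  have fin: "finite (maps (verts G) n)" using simple_graph_finite[OF G] by (simp add: finite_PiE)
  have "card (copies G n) \<le> card {f\<in>maps (verts G) n. inj_on f (verts G)}"
    unfolding copies_eq[OF G] using fin by (intro card_image_le) simp
  also have "\<dots> \<le> card (maps (verts G) n)"
    using fin by (intro card_mono) auto
  also have "\<dots> = n ^ nverts G"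
    by (rule card_maps) (rule simple_graph_finite[OF G])
  finally show ?thesis .
qed

lemma mu_copies_le:
  assumes G: "simple_graph G" and p: "p \<in> {0..1}"
  shows "mu_copies G n p \<le> real n ^ nverts G * p ^ nedges G"
proof -
  have "real (card (copies G n)) \<le> real n ^ nverts G"
    using card_copies_le[OF G, of n] by (simp flip: of_nat_power)
  then show ?thesis
    unfolding mu_copies_eq[OF assms] using p by (intro mult_right_mono) auto
qed

text \<open>Greedy: give colour \<open>y\<close> to \<open>s y\<close> elements, remove them, and
  continue with the remaining colours. This supplies disjoint blocks of prescribed sizes in
  \<open>{1..n}\<close>.\<close>

lemma ex_coloring:
  fixes s :: "'b \<Rightarrow> nat" and A :: "'c set"
  assumes "finite Y" "finite A" "sum s Y \<le> card A"
  shows "\<exists>c. \<forall>y\<in>Y. s y \<le> card {v\<in>A. c v = y}"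
  using assms
proof (induction Y arbitrary: A rule: finite_induct)
  case (insert y Y)
  obtain B where B: "B \<subseteq> A" "card B = s y"
    using insert by (metis le_add1 obtain_subset_with_card_n order_trans sum.insert)
  have "sum s Y \<le> card (A - B)"
    using insert B by (simp add: card_Diff_subset finite_subset)
  then obtain c where c: "\<forall>y\<in>Y. s y \<le> card {v\<in>A-B. c v = y}"
    using insert.IH[of "A - B"] insert.prems by auto
  let ?c = "\<lambda>v. if v \<in> B then y else c v"
  have "s y \<le> card {v\<in>A. ?c v = y}"
    unfolding B(2)[symmetric] using B(1) insert.prems by (intro card_mono) auto
  moreover have "s x \<le> card {v\<in>A. ?c v = x}" if "x \<in> Y" for x
  proof -
    have "card {v\<in>A-B. c v = x} \<le> card {v\<in>A. ?c v = x}"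
      using insert.prems by (intro card_mono) auto
    then show ?thesis using c that by (meson order_trans)
  qed
  ultimately have "\<forall>x\<in>insert y Y. s x \<le> card {v\<in>A. ?c v = x}" by blast
  then show ?case by (intro exI[of _ ?c])
qed simp

text \<open>Colour \<open>{1..n}\<close> by the vertices of \<open>G\<close> and send each vertex
  into its own class. Such maps are injective, and the image determines the map, so no automorphisms
  have to be divided out.\<close>

lemma card_copies_ge:
  assumes G: "simple_graph G"
  shows "(n div nverts G) ^ nverts G \<le> card (copies G n)"
proof -
  have fin: "finite (verts G)" using simple_graph_finite[OF G] by simp
  obtain c where c: "\<forall>y\<in>verts G. n div nverts G \<le> card {v\<in>{1..n}. c v = y}"
    using ex_coloring[of "verts G" "{1..n}" "\<lambda>_. n div nverts G"] fin by auto
  define M where "M = PiE (verts G) (\<lambda>y. {v\<in>{1..n}. c v = y})"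
  have c_inv: "c (f x) = x" if "f \<in> M" "x \<in> verts G" for f x
    using that by (auto simp: M_def)
  have inj: "inj_on (\<lambda>f. image_graph f G) M"
  proof (rule inj_onI)
    fix f g assume fg: "f \<in> M" "g \<in> M" "image_graph f G = image_graph g G"
    then have "f ` verts G = g ` verts G" by (simp add: image_graph_def)
    then have "\<forall>x\<in>verts G. f x = g x"
      using image_eq_left_inverse[of "verts G" c f g "verts G" "verts G"] c_inv fg by blast
    then show "f = g" using fg by (auto simp: M_def intro: PiE_ext)
  qed
  have "(n div nverts G) ^ nverts G = (\<Prod>y\<in>verts G. n div nverts G)" by simp
  also have "\<dots> \<le> (\<Prod>y\<in>verts G. card {v\<in>{1..n}. c v = y})"
    using c by (intro prod_mono) auto
  also have "\<dots> = card M" using fin by (simp add: M_def card_PiE)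
  also have "\<dots> = card ((\<lambda>f. image_graph f G) ` M)" using inj by (simp add: card_image)
  also have "\<dots> \<le> card (copies G n)"
  proof (rule card_mono[OF finite_copies], rule image_subsetI, rule image_graph_copies[OF G])
    fix f assume f: "f \<in> M"
    show "inj_on f (verts G)" by (rule inj_on_inverseI[of _ c]) (rule c_inv[OF f])
    show "f ` verts G \<subseteq> {1..n}" using f unfolding M_def by blast
  qed
  finally show ?thesis .
qed

text \<open>As the integer quotient q is at least 1, n/k \<le> q + 1 \<le> 2 q.\<close>

lemma real_div_ge:
  fixes n k :: nat
  assumes "0 < k" "k \<le> n"
  shows "real n / (2 * real k) \<le> real (n div k)"
proof -
  have "1 \<le> n div k" using assms by (simp add: Suc_le_eq div_greater_zero_iff)
  moreover have "n < k * (n div k) + k"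
    using assms by (metis dividend_less_times_div mult.commute add.commute)
  then have "real n \<le> real k * (real (n div k) + 1)"
    by (metis (no_types, lifting) distrib_left less_imp_le mult.right_neutral of_nat_1 of_nat_add of_nat_le_iff of_nat_mult)
  ultimately have "real n \<le> real k * (2 * real (n div k))"
    by (smt (verit) mult_left_mono of_nat_0_le_iff of_nat_1 of_nat_le_iff)
  then show ?thesis using assms by (simp add: field_simps)
qed

lemma mu_copies_ge:
  assumes G: "simple_graph G" "nverts G \<ge> 1" and p: "p \<in> {0..1}" and n: "nverts G \<le> n"
  shows "real n ^ nverts G * p ^ nedges G \<le> (2 * real (nverts G)) ^ nverts G * mu_copies G n p"
proof -
  have "(real n / (2 * real (nverts G))) ^ nverts G \<le> real (n div nverts G) ^ nverts G"
    using G n by (intro power_mono real_div_ge) auto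
  also have "\<dots> \<le> real (card (copies G n))"
    using card_copies_ge[OF G(1), of n] by (metis of_nat_le_iff of_nat_power)
  finally have "real n ^ nverts G \<le> (2 * real (nverts G)) ^ nverts G * real (card (copies G n))"
    using G by (simp add: power_divide divide_le_eq mult.commute)
  then show ?thesis
    unfolding mu_copies_eq[OF G(1) p] using p
    by (auto simp: mult.assoc[symmetric] intro!: mult_right_mono)
qed

section \<open>The variance\<close>

lemma expectation_num_copies_sq:
  assumes G: "simple_graph G" and p: "p \<in> {0..1}"
  shows "measure_pmf.expectation (Gnp n p) (\<lambda>W. (real (num_copies G W))\<^sup>2)
    = (\<Sum>F\<in>copies G n. \<Sum>F'\<in>copies G n. p ^ card (edges F \<union> edges F'))"
proof -
  have "measure_pmf.expectation (Gnp n p) (\<lambda>W. (real (num_copies G W))\<^sup>2)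
    = measure_pmf.expectation (Gnp n p)
        (\<lambda>W. \<Sum>F\<in>copies G n. \<Sum>F'\<in>copies G n. of_bool (edges F \<union> edges F' \<subseteq> edges W))"
    by (intro integral_cong_AE)
      (auto simp: AE_measure_pmf_iff num_copies_eq_sum power2_eq_square sum_product intro!: sum.cong)
  also have "\<dots> = (\<Sum>F\<in>copies G n. \<Sum>F'\<in>copies G n.
      measure_pmf.expectation (Gnp n p) (\<lambda>W. of_bool (edges F \<union> edges F' \<subseteq> edges W)))"
    by (simp add: Bochner_Integration.integral_sum del: sup.bounded_iff)
  also have "\<dots> = (\<Sum>F\<in>copies G n. \<Sum>F'\<in>copies G n. p ^ card (edges F \<union> edges F'))"
    using copy_edges(1)[OF G] by (intro sum.cong refl expectation_Gnp_edges p Un_least)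
  finally show ?thesis .
qed

lemma variance_eq_sum:
  assumes G: "simple_graph G" and p: "p \<in> {0..1}"
  shows "(sigma_copies G n p)\<^sup>2
    = (\<Sum>F\<in>copies G n. \<Sum>F'\<in>copies G n. p ^ card (edges F \<union> edges F') - p ^ (2 * nedges G))"
proof -
  have "(sigma_copies G n p)\<^sup>2 = measure_pmf.variance (Gnp n p) (\<lambda>W. real (num_copies G W))"
    unfolding sigma_copies_def by (intro real_sqrt_pow2 integral_nonneg_AE) simp
  also have "\<dots> = measure_pmf.expectation (Gnp n p) (\<lambda>W. (real (num_copies G W))\<^sup>2)
      - (mu_copies G n p)\<^sup>2"
    unfolding mu_copies_def by (rule measure_pmf.variance_eq) simp_all
  also have "(mu_copies G n p)\<^sup>2 = (\<Sum>F\<in>copies G n. \<Sum>F'\<in>copies G n. p ^ (2 * nedges G))"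
    unfolding mu_copies_eq[OF assms] by (simp add: power_mult_distrib power2_eq_square power_add mult_2)
  finally show ?thesis
    unfolding expectation_num_copies_sq[OF assms] by (simp only: sum_subtractf)
qed

text \<open>Pull the overlap back to \<open>G\<close>: \<open>D\<close> has all vertices that
  \<open>f\<close> sends into \<open>F'\<close> and all edges that it sends to edges of
  \<open>F'\<close>. The union then has 2 e_G - e_D edges, and the saving p^(-e_D) is at most
  n^(v_D)/\<Phi>.\<close>

lemma overlap_power_le:
  fixes \<Phi> :: real
  assumes G: "simple_graph G" and F': "F' \<in> copies G n"
    and f: "f \<in> maps (verts G) n" "inj_on f (verts G)"
    and ne: "(`) f ` edges G \<inter> edges F' \<noteq> {}"
    and p: "0 < p" "p \<le> 1"
    and \<Phi>: "0 < \<Phi>" "\<And>D. subgraph D G \<Longrightarrow> nedges D \<ge> 1 \<Longrightarrow> \<Phi> \<le> real n ^ nverts D * p ^ nedges D"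
  shows "p ^ card ((`) f ` edges G \<union> edges F')
    \<le> p ^ (2 * nedges G) / \<Phi> * real n ^ card {x\<in>verts G. f x \<in> verts F'}"
proof -
  let ?k = "card ((`) f ` edges G \<inter> edges F')"
  define D where "D = ({x\<in>verts G. f x \<in> verts F'}, {e\<in>edges G. f ` e \<in> edges F'})"
  note finG = simple_graph_finite[OF G]
  have F'_simple: "simple_graph F'" using F' unfolding copies_def subgraph_def by blast
  have "e \<subseteq> {x\<in>verts G. f x \<in> verts F'}" if "e \<in> edges G" "f ` e \<in> edges F'" for e
    using simple_graph_edge(1)[OF G that(1)] simple_graph_edge(1)[OF F'_simple that(2)] by blast
  then have D: "subgraph D G"
    using G finG unfolding subgraph_def simple_graph_def D_def by auto
  have "edges G \<subseteq> Pow (verts G)" using simple_graph_edge(1)[OF G] by blast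
  then have inj: "inj_on ((`) f) (edges G)"
    using inj_on_image_Pow[OF f(2)] by (rule inj_on_subset[rotated])
  have "(`) f ` edges G \<inter> edges F' = (`) f ` edges D"
    unfolding D_def by auto
  moreover have "inj_on ((`) f) (edges D)"
    using inj by (rule inj_on_subset) (auto simp: D_def)
  ultimately have k: "?k = nedges D" by (simp add: card_image)
  have "finite (edges F')" using simple_graph_finite[OF F'_simple] by simp
  then have tot: "card ((`) f ` edges G \<union> edges F') + ?k = 2 * nedges G"
    using card_Un_Int[of "(`) f ` edges G" "edges F'"] finG copy_edges(2)[OF G F'] inj
    by (simp add: card_image)
  have "nedges D \<ge> 1"
    using ne finG k by (simp add: Suc_le_eq card_gt_0_iff flip: k)
  then have "\<Phi> \<le> real n ^ nverts D * p ^ nedges D" using \<Phi>(2)[OF D] by simp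
  then have "p ^ card ((`) f ` edges G \<union> edges F') * \<Phi>
      \<le> p ^ card ((`) f ` edges G \<union> edges F') * (real n ^ nverts D * p ^ nedges D)"
    using p by (intro mult_left_mono) auto
  also have "\<dots> = p ^ (2 * nedges G) * real n ^ nverts D"
    unfolding tot[symmetric] k power_add by simp
  finally show ?thesis
    using \<Phi>(1) by (simp add: pos_le_divide_eq D_def)
qed

text \<open>The weight is a product over the vertices, so the sum factorises. One vertex contributes
  at most |A| n for values in \<open>A\<close> and n for all others.\<close>

lemma sum_maps_power:
  assumes V: "finite V" and A: "finite A" and n: "n \<ge> 1"
  shows "(\<Sum>f\<in>maps V n. real n ^ card {x\<in>V. f x \<in> A}) \<le> (real (card A + 1) * real n) ^ card V"
proof -
  have "(\<Sum>f\<in>maps V n. real n ^ card {x\<in>V. f x \<in> A})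
      = (\<Sum>f\<in>maps V n. \<Prod>x\<in>V. if f x \<in> A then real n else 1)"
    using V by (intro sum.cong refl) (simp add: prod.If_cases Int_def)
  also have "\<dots> = (\<Prod>x\<in>V. \<Sum>y\<in>{1..n}. if y \<in> A then real n else 1)"
    using V by (subst prod_sum_PiE) auto
  also have "(\<Sum>y\<in>{1..n}. if y \<in> A then real n else 1) \<le> real (card A) * real n + real n"
  proof -
    have "(\<Sum>y\<in>{1..n}. if y \<in> A then real n else 1) \<le> (\<Sum>y\<in>{1..n}. (if y \<in> A then real n else 0) + 1)"
      by (intro sum_mono) auto
    also have "\<dots> = real (card ({1..n} \<inter> A)) * real n + real n"
      by (simp add: sum.distrib sum.If_cases Int_def)
    also have "card ({1..n} \<inter> A) \<le> card A" using A by (intro card_mono) auto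
    finally show ?thesis using n by simp
  qed
  then have "(\<Prod>x\<in>V. \<Sum>y\<in>{1..n}. if y \<in> A then real n else 1) \<le> (\<Prod>x\<in>V. real (card A + 1) * real n)"
    by (intro prod_mono conjI sum_nonneg) (auto simp: algebra_simps)
  finally show ?thesis by simp
qed

text \<open>Only pairs of copies that share an edge contribute. For a fixed \<open>F'\<close>, a map
  with k vertices in \<open>F'\<close> carries the weight n^k from \<open>overlap_power_le\<close>,
  which compensates for there being only O(n^(v-k)) such maps; this gives the order (n^v
  p^e)^2/\<Phi>.\<close>

lemma variance_le:
  fixes \<Phi> :: real
  assumes G: "simple_graph G" and n: "n \<ge> 1" and p: "0 < p" "p \<le> 1"
    and \<Phi>: "0 < \<Phi>" "\<And>D. subgraph D G \<Longrightarrow> nedges D \<ge> 1 \<Longrightarrow> \<Phi> \<le> real n ^ nverts D * p ^ nedges D"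
  shows "(sigma_copies G n p)\<^sup>2
    \<le> real (nverts G + 1) ^ nverts G * (real n ^ nverts G * p ^ nedges G)\<^sup>2 / \<Phi>"
proof -
  let ?v = "nverts G" and ?e = "nedges G"
  note finG = simple_graph_finite[OF G]
  have finM: "finite (maps (verts G) n)" using finG by (simp add: finite_PiE)
  define h where "h = (\<lambda>F F' :: nat ugraph.
    if edges F \<inter> edges F' \<noteq> {} then p ^ card (edges F \<union> edges F') else 0)"
  have h0: "h F F' \<ge> 0" for F F' using p by (simp add: h_def)
  have 1: "p ^ card (edges F \<union> edges F') - p ^ (2 * ?e) \<le> h F F'"
    if F: "F \<in> copies G n" "F' \<in> copies G n" for F F'
  proof (cases "edges F \<inter> edges F' = {}")
    case True
    have "finite (edges F)" "finite (edges F')"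
      using copy_edges(1)[OF G] F finite_subset[OF _ finite_complete_edges] by blast+
    then have "card (edges F \<union> edges F') = 2 * ?e"
      using True copy_edges(2)[OF G] F by (simp add: card_Un_disjoint)
    then show ?thesis using h0 by simp
  qed (use p in \<open>simp add: h_def\<close>)
  have 2: "(\<Sum>F\<in>copies G n. h F F') \<le> p ^ (2 * ?e) / \<Phi> * (real (?v + 1) * real n) ^ ?v"
    if F': "F' \<in> copies G n" for F'
  proof -
    let ?I = "{f\<in>maps (verts G) n. inj_on f (verts G)}"
    obtain g where g: "F' = image_graph g G" "inj_on g (verts G)"
      using F' unfolding copies_eq[OF G] by blast
    then have card: "card (verts F') = ?v" "finite (verts F')"
      using finG by (simp_all add: image_graph_def card_image)
    \<comment> \<open>A copy may be the image of several maps; as \<open>h\<close> is nonnegative,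
      counting it repeatedly only increases the sum.\<close>
    have "(\<Sum>F\<in>copies G n. h F F') \<le> (\<Sum>f\<in>?I. h (image_graph f G) F')"
      unfolding copies_eq[OF G] using sum_image_le[of ?I "\<lambda>F. h F F'" "\<lambda>f. image_graph f G"] finM h0
      by (simp add: o_def)
    also have "\<dots> \<le> (\<Sum>f\<in>?I. p ^ (2 * ?e) / \<Phi> * real n ^ card {x\<in>verts G. f x \<in> verts F'})"
    proof (rule sum_mono)
      fix f assume f: "f \<in> ?I"
      show "h (image_graph f G) F' \<le> p ^ (2 * ?e) / \<Phi> * real n ^ card {x\<in>verts G. f x \<in> verts F'}"
        using overlap_power_le[OF G F' _ _ _ p \<Phi>, of f] f p \<Phi>(1)
        by (simp add: h_def image_graph_def)
    qed
    also have "\<dots> \<le> (\<Sum>f\<in>maps (verts G) n. p ^ (2 * ?e) / \<Phi> * real n ^ card {x\<in>verts G. f x \<in> verts F'})"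
      using finM p \<Phi>(1) by (intro sum_mono2) auto
    also have "\<dots> = p ^ (2 * ?e) / \<Phi> * (\<Sum>f\<in>maps (verts G) n. real n ^ card {x\<in>verts G. f x \<in> verts F'})"
      by (simp add: sum_distrib_left)
    also have "\<dots> \<le> p ^ (2 * ?e) / \<Phi> * (real (?v + 1) * real n) ^ ?v"
      using sum_maps_power[OF finG(1) card(2) n] p \<Phi>(1) unfolding card(1) by (intro mult_left_mono) auto
    finally show ?thesis .
  qed
  have "(sigma_copies G n p)\<^sup>2
      = (\<Sum>F\<in>copies G n. \<Sum>F'\<in>copies G n. p ^ card (edges F \<union> edges F') - p ^ (2 * ?e))"
    using p by (intro variance_eq_sum G) auto
  also have "\<dots> \<le> (\<Sum>F\<in>copies G n. \<Sum>F'\<in>copies G n. h F F')"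
    by (intro sum_mono 1)
  also have "\<dots> = (\<Sum>F'\<in>copies G n. \<Sum>F\<in>copies G n. h F F')"
    by (rule sum.swap)
  also have "\<dots> \<le> (\<Sum>F'\<in>copies G n. p ^ (2 * ?e) / \<Phi> * (real (?v + 1) * real n) ^ ?v)"
    by (intro sum_mono 2)
  also have "\<dots> = real (card (copies G n)) * (p ^ (2 * ?e) / \<Phi> * (real (?v + 1) * real n) ^ ?v)"
    by simp
  also have "\<dots> \<le> real n ^ ?v * (p ^ (2 * ?e) / \<Phi> * (real (?v + 1) * real n) ^ ?v)"
    using card_copies_le[OF G, of n] p \<Phi>(1)
    by (intro mult_right_mono) (simp_all flip: of_nat_power)
  also have "\<dots> = real (?v + 1) ^ ?v * (real n ^ ?v * p ^ ?e)\<^sup>2 / \<Phi>"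
    by (simp add: power_mult_distrib power2_eq_square mult_2 power_add)
  finally show ?thesis .
qed

text \<open>Zero variance would make the count constant on the support. For p < 1 the support
  contains the empty graph, which has no copy of \<open>G\<close>, whereas the mean is not
  0.\<close>

lemma sigma_copies_pos:
  assumes G: "simple_graph G" "nedges G \<ge> 1" and p: "0 \<le> p" "p < 1" and \<mu>: "mu_copies G n p \<noteq> 0"
  shows "sigma_copies G n p > 0"
proof (rule ccontr)
  let ?M = "measure_pmf (Gnp n p)" and ?X = "\<lambda>W. real (num_copies G W)"
  assume "\<not> sigma_copies G n p > 0"
  moreover have "measure_pmf.variance (Gnp n p) ?X \<ge> 0"
    by (intro integral_nonneg_AE) simp
  ultimately have "measure_pmf.variance (Gnp n p) ?X = 0"
    by (simp add: sigma_copies_def)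
  then have "AE W in ?M. (?X W - measure_pmf.expectation (Gnp n p) ?X)\<^sup>2 = 0"
    by (subst (asm) integral_nonneg_eq_0_iff_AE) auto
  then have X: "?X W = mu_copies G n p" if "W \<in> set_pmf (Gnp n p)" for W
    using that by (simp add: AE_measure_pmf_iff mu_copies_def)
  have "False \<in> set_pmf (bernoulli_pmf p)"
    using p by (simp add: set_pmf_eq)
  then have "(\<lambda>_. False) \<in> set_pmf (Pi_pmf (complete_edges n) False (\<lambda>_. bernoulli_pmf p))"
    by (simp add: set_Pi_pmf PiE_dflt_def)
  then have "({1..n}, {e \<in> complete_edges n. False}) \<in> set_pmf (Gnp n p)"
    unfolding Gnp_def set_map_pmf by (rule image_eqI[rotated]) simp
  then have W: "({1..n}, {}) \<in> set_pmf (Gnp n p)" by simp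
  have "edges F \<noteq> {}" if "F \<in> copies G n" for F
    using copy_edges(2)[OF G(1) that] G(2) by auto
  then have none: "{F \<in> copies G n. edges F \<subseteq> {}} = {}" by blast
  have "num_copies G ({1..n}, {}) = card {F \<in> copies G n. edges F \<subseteq> {}}"
    using num_copies_eq_card[of "({1..n}, {})" n G] unfolding fst_conv snd_conv by blast
  then have "num_copies G ({1..n}, {}) = 0"
    unfolding none by (simp only: card.empty)
  then show False using X[OF W] \<mu> by simp
qed

section \<open>Planting a blow-up\<close>

text \<open>The sets \<open>U i\<close> are the vertex sets of the covers \<open>J i\<close> of the primal graph on \<open>U0\<close>. The
  planted graph consists of one copy of \<open>U0\<close>, with label \<open>0\<close>, and \<open>z\<close> labelled copies of each
  \<open>U i - U0\<close>; choosing a label \<open>j i\<close> for every \<open>i\<close> yields \<open>z ^ card I\<close> copies of \<open>K\<close>.\<close>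

locale blowup =
  fixes H :: "'a ugraph" and I :: "'i set" and U0 :: "'a set" and U :: "'i \<Rightarrow> 'a set" and m :: real
  assumes H: "simple_graph H"
    and m: "0 < m"
    and density: "\<And>S. S \<subseteq> verts H \<Longrightarrow> real (card (edges_on H S)) \<le> m * real (card S)"
    and I: "finite I" "I \<noteq> {}"
    and U: "\<And>i. i \<in> I \<Longrightarrow> U0 \<subset> U i" "\<And>i. i \<in> I \<Longrightarrow> U i \<subseteq> verts H"
    and U_Int: "\<And>i j. i \<in> I \<Longrightarrow> j \<in> I \<Longrightarrow> i \<noteq> j \<Longrightarrow> U i \<inter> U j = U0"
    and tight0: "real (card (edges_on H U0)) = m * real (card U0)"
    and tightK: "real (card (edges_on H (\<Union>i\<in>I. U i))) = m * real (card (\<Union>i\<in>I. U i))"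
    and edges_K: "\<And>e. e \<in> edges H \<Longrightarrow> e \<subseteq> (\<Union>i\<in>I. U i) \<Longrightarrow> \<exists>i\<in>I. e \<subseteq> U i"
begin

definition K :: "'a set" where "K = (\<Union>i\<in>I. U i)"

definition R :: "'a set" where "R = verts H - K"

text \<open>A planted vertex is a vertex of \<open>H\<close> with a label. Label 0 is reserved for
  the single shared copy of \<open>U0\<close>; the attached copies have labels from 1 on.\<close>

definition lift :: "nat \<Rightarrow> 'a \<Rightarrow> 'a \<times> nat" where
  "lift k x = (x, if x \<in> U0 then 0 else k)"

definition VF :: "nat \<Rightarrow> ('a \<times> nat) set" where
  "VF z = (\<Union>i\<in>I. \<Union>k\<in>{1..z}. lift k ` U i)"

definition EF :: "nat \<Rightarrow> ('a \<times> nat) set set" where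
  "EF z = (\<Union>i\<in>I. \<Union>k\<in>{1..z}. (`) (lift k) ` edges_on H (U i))"

definition idx :: "'a \<Rightarrow> 'i" where
  "idx x = (THE i. i \<in> I \<and> x \<in> U i)"

text \<open>On \<open>K\<close> this is the embedding into the blow-up that uses copy
  \<open>j i\<close> of each cover \<open>i\<close>. The label 0 off \<open>K\<close> is the one
  under which the vertices of \<open>R\<close> get their blocks; no planted vertex has a first
  component there.\<close>

definition lab :: "('i \<Rightarrow> nat) \<Rightarrow> 'a \<Rightarrow> 'a \<times> nat" where
  "lab j x = (x, if x \<in> K - U0 then j (idx x) else 0)"

definition new_edges :: "'a set set" where
  "new_edges = {e \<in> edges H. \<not> e \<subseteq> K}"

lemmas fin = simple_graph_finite[OF H]

lemma K_subset: "K \<subseteq> verts H" and U0_subset: "U0 \<subseteq> K" "U0 \<subseteq> verts H"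
  using U I unfolding K_def by blast+

lemma finite_sets: "finite K" "finite U0" "finite R" "finite new_edges"
  using fin K_subset U0_subset finite_subset unfolding R_def new_edges_def by auto

lemma idx_eq:
  assumes "i \<in> I" "x \<in> U i" "x \<notin> U0"
  shows "idx x = i"
  unfolding idx_def using assms U_Int by (intro the_equality) blast+

lemma lab_eq_lift: "i \<in> I \<Longrightarrow> x \<in> U i \<Longrightarrow> lab j x = lift (j i) x"
  using idx_eq[of i x] U0_subset by (auto simp: lab_def lift_def K_def)

lemma fst_lab [simp]: "fst (lab j x) = x"
  by (simp add: lab_def)

lemma lab_VF: "j \<in> PiE I (\<lambda>_. {1..z}) \<Longrightarrow> x \<in> K \<Longrightarrow> lab j x \<in> VF z"
  using lab_eq_lift by (force simp: K_def VF_def)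

lemma inj_lift: "inj_on (lift k) A"
  by (auto simp: inj_on_def lift_def)

text \<open>\<open>T\<close> and \<open>S\<close> together span at most m (|T| + |S|) edges, and
  \<open>T\<close> alone already spans m |T|. This is applied to the tight sets \<open>U0\<close>
  and \<open>K\<close>.\<close>

lemma tight_extension:
  assumes T: "T \<subseteq> verts H" "real (card (edges_on H T)) = m * real (card T)"
    and S: "S \<subseteq> verts H" "S \<inter> T = {}"
  shows "real (card {e \<in> edges_on H (T \<union> S). \<not> e \<subseteq> T}) \<le> m * real (card S)"
proof -
  let ?N = "{e \<in> edges_on H (T \<union> S). \<not> e \<subseteq> T}"
  have "card (edges_on H T \<union> ?N) = card (edges_on H T) + card ?N"
    using fin(2) by (intro card_Un_disjoint) auto
  moreover have "edges_on H (T \<union> S) = edges_on H T \<union> ?N" by auto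
  ultimately have "card (edges_on H (T \<union> S)) = card (edges_on H T) + card ?N" by metis
  moreover have "card (T \<union> S) = card T + card S"
    using S T fin finite_subset by (intro card_Un_disjoint) blast+
  ultimately show ?thesis
    using density[of "T \<union> S"] T S by (simp add: algebra_simps)
qed

section \<open>Size and density of the planted graph\<close>

lemma finite_VF [simp]: "finite (VF z)"
proof -
  have "finite (U i)" if "i \<in> I" for i using U(2)[OF that] fin(1) by (rule finite_subset)
  then show ?thesis unfolding VF_def using I by simp
qed

lemma finite_EF [simp]: "finite (EF z)"
  unfolding EF_def using I fin(2) by auto

lemma card_VF_le: "z \<ge> 1 \<Longrightarrow> card (VF z) \<le> card (verts H) * z"
proof -
  assume z: "z \<ge> 1"
  have "VF z \<subseteq> U0 \<times> {0} \<union> (K - U0) \<times> {1..z}"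
    unfolding VF_def lift_def K_def by (auto split: if_splits)
  then have "card (VF z) \<le> card (U0 \<times> {0::nat} \<union> (K - U0) \<times> {1..z})"
    using finite_sets by (intro card_mono) auto
  also have "\<dots> \<le> card (U0 \<times> {0::nat}) + card ((K - U0) \<times> {1..z})"
    by (rule card_Un_le)
  also have "\<dots> = card U0 + card (K - U0) * z"
    by (simp add: card_cartesian_product)
  also have "\<dots> \<le> card U0 * z + card (K - U0) * z"
    using z by simp
  also have "\<dots> = card K * z"
    using card_Diff_subset[of U0 K] U0_subset(1) finite_sets card_mono[of K U0]
    by (simp flip: add_mult_distrib)
  also have "\<dots> \<le> card (verts H) * z"
    using K_subset fin(1) by (intro mult_right_mono card_mono) auto
  finally show ?thesis .
qed

lemma EF_edge:
  assumes "e \<in> EF z"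
  shows "e \<subseteq> VF z" "card e = 2"
proof -
  obtain i k d where d: "i \<in> I" "k \<in> {1..z}" "d \<in> edges H" "d \<subseteq> U i" "e = lift k ` d"
    using assms unfolding EF_def by blast
  then show "e \<subseteq> VF z" unfolding VF_def by blast
  show "card e = 2"
    using d simple_graph_edge(2)[OF H d(3)] inj_lift by (simp add: card_image)
qed

lemma EF_simple: "simple_graph (VF z, EF z)"
  using EF_edge by (auto simp: simple_graph_def)

text \<open>Split \<open>S\<close> into its part \<open>S0\<close> in the shared copy and the parts
  \<open>T (i, k)\<close> in the attached copies. The first spans at most m |S0| edges. Every other
  edge lies in a single attached copy, and since \<open>U0\<close> is tight, copy (i, k) adds at
  most m |T (i, k)| of them.\<close>

lemma EF_density:
  assumes S: "S \<subseteq> VF z"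
  shows "real (card {e \<in> EF z. e \<subseteq> S}) \<le> m * real (card S)"
proof -
  define S0 where "S0 = {x \<in> U0. (x, 0) \<in> S}"
  define T where "T = (\<lambda>(i, k). {x \<in> U i - U0. (x, k) \<in> S})"
  define P where "P = I \<times> {1..z}"
  have finP: "finite P" using I by (simp add: P_def)
  have finS: "finite S" by (rule finite_subset[OF S finite_VF])
  have T_sub: "T c \<subseteq> verts H" "T c \<inter> U0 = {}" if "c \<in> P" for c
    using that U(2) by (auto simp: T_def P_def)
  have finT: "finite (T c)" if "c \<in> P" for c
    using T_sub[OF that] fin(1) finite_subset by blast
  \<comment> \<open>All of \<open>U0\<close> is allowed here, not just \<open>S0\<close>: the bound
    needs a tight base, and enlarging the base only adds edges.\<close>
  define N where "N = (\<lambda>c. {e \<in> edges_on H (U0 \<union> T c). \<not> e \<subseteq> U0})"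
  have "{e \<in> EF z. e \<subseteq> S} \<subseteq> (`) (lift 0) ` edges_on H S0 \<union> (\<Union>c\<in>P. (`) (lift (snd c)) ` N c)"
  proof
    fix e assume "e \<in> {e \<in> EF z. e \<subseteq> S}"
    then obtain i k d where d: "i \<in> I" "k \<in> {1..z}" "d \<in> edges H" "d \<subseteq> U i" "e = lift k ` d" "e \<subseteq> S"
      unfolding EF_def by blast
    have dS: "lift k x \<in> S" if "x \<in> d" for x using d that by blast
    show "e \<in> (`) (lift 0) ` edges_on H S0 \<union> (\<Union>c\<in>P. (`) (lift (snd c)) ` N c)"
    proof (cases "d \<subseteq> U0")
      case True
      then have "e = lift 0 ` d" unfolding d(5) by (intro image_cong) (auto simp: lift_def)
      moreover have "d \<subseteq> S0"
        using True dS by (auto simp: S0_def lift_def subset_iff)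
      ultimately show ?thesis using d by blast
    next
      case False
      have "d \<subseteq> U0 \<union> T (i, k)"
      proof
        fix x assume "x \<in> d"
        then show "x \<in> U0 \<union> T (i, k)"
          using dS[of x] d(4) by (cases "x \<in> U0") (auto simp: T_def lift_def)
      qed
      then have "d \<in> N (i, k)" using d False by (simp add: N_def)
      moreover have "(i, k) \<in> P" using d by (simp add: P_def)
      ultimately show ?thesis using d(5) by force
    qed
  qed
  then have "card {e \<in> EF z. e \<subseteq> S}
      \<le> card ((`) (lift 0) ` edges_on H S0 \<union> (\<Union>c\<in>P. (`) (lift (snd c)) ` N c))"
    using finP fin(2) by (intro card_mono) (auto simp: N_def)
  also have "\<dots> \<le> card ((`) (lift 0) ` edges_on H S0) + card (\<Union>c\<in>P. (`) (lift (snd c)) ` N c)"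
    by (rule card_Un_le)
  also have "\<dots> \<le> card (edges_on H S0) + (\<Sum>c\<in>P. card (N c))"
    using fin(2) finP
    by (intro add_mono card_image_le order_trans[OF card_UN_le] sum_mono) (auto simp: N_def)
  finally have le: "card {e \<in> EF z. e \<subseteq> S} \<le> card (edges_on H S0) + (\<Sum>c\<in>P. card (N c))" .
  have "real (card {e \<in> EF z. e \<subseteq> S}) \<le> real (card (edges_on H S0)) + (\<Sum>c\<in>P. real (card (N c)))"
    using of_nat_mono[OF le, where 'a = real] by (simp only: of_nat_add of_nat_sum)
  also have "\<dots> \<le> m * real (card S0) + (\<Sum>c\<in>P. m * real (card (T c)))"
  proof (intro add_mono sum_mono)
    show "real (card (edges_on H S0)) \<le> m * real (card S0)"
      using U0_subset by (intro density) (auto simp: S0_def)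
    fix c assume "c \<in> P"
    then show "real (card (N c)) \<le> m * real (card (T c))"
      unfolding N_def using T_sub by (intro tight_extension U0_subset tight0)
  qed
  also have "\<dots> = m * real (card S0 + (\<Sum>c\<in>P. card (T c)))"
    by (simp add: sum_distrib_left algebra_simps)
  also have "card S0 + (\<Sum>c\<in>P. card (T c)) \<le> card S"
  proof -
    have "(\<Sum>c\<in>P. card (T c)) = (\<Sum>c\<in>P. card (T c \<times> {snd c}))"
      by (simp add: card_cartesian_product)
    also have "\<dots> = card (\<Union>c\<in>P. T c \<times> {snd c})"
    \<comment> \<open>Parts with equal labels belong to different covers, and these meet only in
      \<open>U0\<close>, which \<open>T\<close> omits.\<close>
    proof (rule card_UN_disjoint[symmetric])
      show "\<forall>c\<in>P. \<forall>d\<in>P. c \<noteq> d \<longrightarrow> T c \<times> {snd c} \<inter> T d \<times> {snd d} = {}"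
        using U_Int by (fastforce simp: P_def T_def)
    qed (use finP finT in auto)
    finally have "card S0 + (\<Sum>c\<in>P. card (T c)) = card (S0 \<times> {0::nat}) + card (\<Union>c\<in>P. T c \<times> {snd c})"
      by (simp add: card_cartesian_product)
    also have "\<dots> = card (S0 \<times> {0} \<union> (\<Union>c\<in>P. T c \<times> {snd c}))"
      using finP finT finite_sets(2)
      by (intro card_Un_disjoint[symmetric]) (auto simp: S0_def P_def T_def)
    also have "\<dots> \<le> card S"
      using finS by (intro card_mono) (auto simp: S0_def T_def)
    finally show ?thesis .
  qed
  then have "m * real (card S0 + (\<Sum>c\<in>P. card (T c))) \<le> m * real (card S)"
    using m by (simp only: mult_le_cancel_left_pos of_nat_le_iff)
  finally show ?thesis .
qed

end

text \<open>A vertex of the planted graph, or of \<open>R\<close>, is only embedded into the block of its own label under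
  the colouring \<open>blk\<close>; then maps are injective automatically and a copy determines its embedding.\<close>

locale planting = blowup H I U0 U m
  for H :: "'a ugraph" and I :: "'i set" and U0 U m +
  fixes n z s1 s2 :: nat and p :: real and blk :: "nat \<Rightarrow> 'a \<times> nat"
  assumes p: "0 < p" "p \<le> 1" and z: "z \<ge> 1" and s: "s1 > 0" "s2 > 0"
    and blk1: "\<And>y. y \<in> VF z \<Longrightarrow> s1 \<le> card {v\<in>{1..n}. blk v = y}"
    and blk2: "\<And>x. x \<in> R \<Longrightarrow> s2 \<le> card {v\<in>{1..n}. blk v = (x, 0)}"
begin

definition block :: "'a \<times> nat \<Rightarrow> nat set" where
  "block y = {v\<in>{1..n}. blk v = y}"

definition Phis :: "('a \<times> nat \<Rightarrow> nat) set" where "Phis = PiE (VF z) block"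

definition Rhos :: "('a \<Rightarrow> nat) set" where "Rhos = PiE R (\<lambda>x. block (x, 0))"

definition Js :: "('i \<Rightarrow> nat) set" where "Js = PiE I (\<lambda>_. {1..z})"

text \<open>An extension \<open>c = (j, \<rho>)\<close> of the planted copy \<open>\<phi>\<close>
  selects a copy of \<open>K\<close> inside it through the labels \<open>j\<close> and places the
  remaining vertices of \<open>H\<close> through \<open>\<rho>\<close>.\<close>

definition \<theta> :: "('a \<times> nat \<Rightarrow> nat) \<Rightarrow> ('i \<Rightarrow> nat) \<times> ('a \<Rightarrow> nat) \<Rightarrow> 'a \<Rightarrow> nat" where
  "\<theta> \<phi> c x = (if x \<in> K then \<phi> (lab (fst c) x) else snd c x)"

definition EP :: "('a \<times> nat \<Rightarrow> nat) \<Rightarrow> nat set set" where "EP \<phi> = (`) \<phi> ` EF z"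

text \<open>Only edges that leave \<open>K\<close> are required: those inside \<open>K\<close> lie
  in some \<open>U i\<close> and are present once the planted copy is.\<close>

definition EN :: "('a \<times> nat \<Rightarrow> nat) \<Rightarrow> ('i \<Rightarrow> nat) \<times> ('a \<Rightarrow> nat) \<Rightarrow> nat set set" where
  "EN \<phi> c = (`) (\<theta> \<phi> c) ` new_edges"

section \<open>Colour-respecting embeddings and their edge sets\<close>

lemma finite_families: "finite Phis" "finite Rhos" "finite Js" "finite (Js \<times> Rhos)"
  using I finite_sets by (auto simp: Phis_def Rhos_def Js_def block_def intro!: finite_PiE)

lemma \<phi>_props: "\<phi> \<in> Phis \<Longrightarrow> y \<in> VF z \<Longrightarrow> \<phi> y \<in> {1..n} \<and> blk (\<phi> y) = y"
  by (auto simp: Phis_def block_def PiE_iff)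

lemma inj_\<phi>: "\<phi> \<in> Phis \<Longrightarrow> inj_on \<phi> (VF z)"
  using \<phi>_props by (intro inj_on_inverseI[of _ blk]) blast

lemma \<theta>_props:
  assumes "\<phi> \<in> Phis" "c \<in> Js \<times> Rhos" "x \<in> verts H"
  shows "\<theta> \<phi> c x \<in> {1..n}" "blk (\<theta> \<phi> c x) = lab (fst c) x"
proof -
  have c: "fst c \<in> Js" "snd c \<in> Rhos" using assms(2) by auto
  have "\<theta> \<phi> c x \<in> {1..n} \<and> blk (\<theta> \<phi> c x) = lab (fst c) x"
  proof (cases "x \<in> K")
    case True
    then show ?thesis
      using \<phi>_props[OF assms(1) lab_VF[of "fst c" z x]] c(1) by (simp add: \<theta>_def Js_def)
  next
    case False
    then have "snd c x \<in> block (x, 0)"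
      using c(2) assms(3) by (auto simp: Rhos_def R_def PiE_iff)
    then show ?thesis using False by (simp add: \<theta>_def block_def lab_def)
  qed
  then show "\<theta> \<phi> c x \<in> {1..n}" "blk (\<theta> \<phi> c x) = lab (fst c) x" by blast+
qed

lemma \<theta>_inverse: "\<phi> \<in> Phis \<Longrightarrow> c \<in> Js \<times> Rhos \<Longrightarrow> x \<in> verts H \<Longrightarrow> (fst \<circ> blk) (\<theta> \<phi> c x) = x"
  using \<theta>_props(2) by simp

lemma inj_\<theta>: "\<phi> \<in> Phis \<Longrightarrow> c \<in> Js \<times> Rhos \<Longrightarrow> inj_on (\<theta> \<phi> c) (verts H)"
  using \<theta>_inverse by (rule inj_on_inverseI)

lemma EP_complete: "\<phi> \<in> Phis \<Longrightarrow> EP \<phi> \<subseteq> complete_edges n"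
proof -
  assume \<phi>: "\<phi> \<in> Phis"
  then have "\<phi> ` VF z \<subseteq> {1..n}" using \<phi>_props by blast
  then show ?thesis
    unfolding EP_def using image_edges_complete[OF EF_simple, of \<phi> z n] inj_\<phi>[OF \<phi>] by simp
qed

lemma EN_complete:
  assumes "\<phi> \<in> Phis" "c \<in> Js \<times> Rhos"
  shows "EN \<phi> c \<subseteq> complete_edges n"
proof -
  have "\<theta> \<phi> c ` verts H \<subseteq> {1..n}" using \<theta>_props(1)[OF assms] by blast
  from image_edges_complete[OF H inj_\<theta>[OF assms] this] show ?thesis
    by (auto simp: EN_def new_edges_def)
qed

lemma card_EP: "\<phi> \<in> Phis \<Longrightarrow> card (EP \<phi>) = card (EF z)"
proof -
  assume "\<phi> \<in> Phis"
  moreover have "EF z \<subseteq> Pow (VF z)" using EF_edge(1) by blast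
  ultimately have "inj_on ((`) \<phi>) (EF z)"
    using inj_on_image_Pow[OF inj_\<phi>] inj_on_subset by blast
  then show ?thesis by (simp add: EP_def card_image)
qed

lemma card_EN:
  assumes "\<phi> \<in> Phis" "c \<in> Js \<times> Rhos"
  shows "card (EN \<phi> c) = card new_edges"
proof -
  have "new_edges \<subseteq> Pow (verts H)" using simple_graph_edge(1)[OF H] unfolding new_edges_def by blast
  then have "inj_on ((`) (\<theta> \<phi> c)) new_edges"
    using inj_on_image_Pow[OF inj_\<theta>[OF assms]] inj_on_subset by blast
  then show ?thesis by (simp add: EN_def card_image)
qed

text \<open>A new edge has a vertex x outside \<open>K\<close>, and the colour of its image still
  shows x. Images of planted vertices have colours whose first component lies in
  \<open>K\<close>.\<close>

lemma EP_EN_disjoint: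
  assumes "\<phi> \<in> Phis" "c \<in> Js \<times> Rhos"
  shows "EP \<phi> \<inter> EN \<phi> c = {}"
proof (rule ccontr)
  assume "EP \<phi> \<inter> EN \<phi> c \<noteq> {}"
  then obtain d e where de: "d \<in> EF z" "e \<in> new_edges" "\<phi> ` d = \<theta> \<phi> c ` e"
    unfolding EP_def EN_def by blast
  obtain x where x: "x \<in> e" "x \<notin> K" using de(2) by (auto simp: new_edges_def)
  have xH: "x \<in> verts H" using de(2) x simple_graph_edge(1)[OF H] by (auto simp: new_edges_def)
  obtain y where y: "y \<in> d" "\<theta> \<phi> c x = \<phi> y" using de(3) x by blast
  have yV: "y \<in> VF z" using EF_edge(1)[OF de(1)] y by blast
  have "x = fst (blk (\<phi> y))" using \<theta>_inverse[OF assms xH] y by simp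
  also have "\<dots> = fst y" using \<phi>_props[OF assms(1) yV] by simp
  also have "\<dots> \<in> K" using yV by (auto simp: VF_def K_def lift_def)
  finally show False using x by simp
qed

lemma card_EP_EN:
  assumes "\<phi> \<in> Phis" "c \<in> Js \<times> Rhos" "c' \<in> Js \<times> Rhos"
  shows "card (EP \<phi> \<union> EN \<phi> c) = card (EF z) + card new_edges"
    and "card (EP \<phi> \<union> EN \<phi> c \<union> EN \<phi> c') = card (EF z) + card (EN \<phi> c \<union> EN \<phi> c')"
proof -
  have fin: "finite (EP \<phi>)" "finite (EN \<phi> c)" "finite (EN \<phi> c')"
    using finite_sets by (auto simp: EP_def EN_def)
  show "card (EP \<phi> \<union> EN \<phi> c) = card (EF z) + card new_edges"
    using fin EP_EN_disjoint assms card_EP card_EN by (simp add: card_Un_disjoint)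
  have "EP \<phi> \<inter> (EN \<phi> c \<union> EN \<phi> c') = {}" using EP_EN_disjoint assms by blast
  then show "card (EP \<phi> \<union> EN \<phi> c \<union> EN \<phi> c') = card (EF z) + card (EN \<phi> c \<union> EN \<phi> c')"
    unfolding Un_assoc using fin card_EP[OF assms(1)] by (subst card_Un_disjoint) auto
qed

text \<open>\<open>DR\<close> and \<open>DF\<close> bound the ratio of the second moment to the
  squared first moment: \<open>DR\<close> for the extensions of a fixed planted copy,
  \<open>DF\<close> for the planted copies.\<close>

definition DR :: real where "DR = (1 + p powr (- m) / real s2) ^ card R"

definition DF :: real where "DF = (1 + p powr (- m) / real s1) ^ card (VF z)"

lemma DR_pos: "DR > 0" and DF_pos: "DF > 0"
  by (auto simp: DR_def DF_def intro!: zero_less_power add_pos_nonneg)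

text \<open>As \<open>K\<close> is tight, agreement on \<open>K\<close> costs nothing and only
  agreement on \<open>R\<close> is charged. The pair sum therefore splits into |Js|^2, with no loss
  for the choice of labels, and a sum over pairs of placements of \<open>R\<close>.\<close>

lemma sum_EN_pairs:
  assumes \<phi>: "\<phi> \<in> Phis"
  shows "(\<Sum>c\<in>Js \<times> Rhos. \<Sum>c'\<in>Js \<times> Rhos. p ^ card (EN \<phi> c \<union> EN \<phi> c'))
    \<le> p ^ (2 * card new_edges) * ((real (card (Js \<times> Rhos)))\<^sup>2 * DR)"
proof -
  define g where "g = (\<lambda>\<rho> \<rho>' :: 'a \<Rightarrow> nat. \<Prod>x\<in>R. if \<rho> x = \<rho>' x then p powr (- m) else 1)"
  have 1: "p ^ card (EN \<phi> c \<union> EN \<phi> c') \<le> p ^ (2 * card new_edges) * g (snd c) (snd c')"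
    if c: "c \<in> Js \<times> Rhos" "c' \<in> Js \<times> Rhos" for c c'
  proof -
    let ?S = "{x\<in>R. \<theta> \<phi> c x = \<theta> \<phi> c' x}"
    have sub: "e \<subseteq> verts H" if "e \<in> new_edges" for e
      using that simple_graph_edge(1)[OF H] by (simp add: new_edges_def)
    \<comment> \<open>The two extensions are treated as if they agreed on all of \<open>K\<close>,
      so that the tightness of \<open>K\<close> applies.\<close>
    have "{e\<in>new_edges. \<forall>x\<in>e. \<theta> \<phi> c x = \<theta> \<phi> c' x} \<subseteq> {e \<in> edges_on H (K \<union> ?S). \<not> e \<subseteq> K}"
      using sub by (auto simp: new_edges_def R_def)
    then have "card {e\<in>new_edges. \<forall>x\<in>e. \<theta> \<phi> c x = \<theta> \<phi> c' x} \<le> card {e \<in> edges_on H (K \<union> ?S). \<not> e \<subseteq> K}"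
      using fin(2) by (intro card_mono) auto
    also have "real \<dots> \<le> m * real (card ?S)"
      using tightK by (intro tight_extension K_subset) (auto simp: K_def R_def)
    finally have "p ^ card (EN \<phi> c \<union> EN \<phi> c')
        \<le> p ^ (2 * card new_edges) * (\<Prod>x\<in>R. if \<theta> \<phi> c x = \<theta> \<phi> c' x then p powr (- m) else 1)"
      unfolding EN_def using \<theta>_inverse[OF \<phi> c(1)] \<theta>_inverse[OF \<phi> c(2)] finite_sets p sub
      by (intro power_card_Un_images_le[where V = "verts H" and c = "fst \<circ> blk"]) auto
    also have "(\<Prod>x\<in>R. if \<theta> \<phi> c x = \<theta> \<phi> c' x then p powr (- m) else 1) = g (snd c) (snd c')"
      unfolding g_def by (intro prod.cong) (auto simp: \<theta>_def R_def)
    finally show ?thesis .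
  qed
  have "(\<Sum>c\<in>Js \<times> Rhos. \<Sum>c'\<in>Js \<times> Rhos. p ^ card (EN \<phi> c \<union> EN \<phi> c'))
      \<le> (\<Sum>c\<in>Js \<times> Rhos. \<Sum>c'\<in>Js \<times> Rhos. p ^ (2 * card new_edges) * g (snd c) (snd c'))"
    by (intro sum_mono 1)
  also have "\<dots> = p ^ (2 * card new_edges) * (\<Sum>c\<in>Js \<times> Rhos. \<Sum>c'\<in>Js \<times> Rhos. g (snd c) (snd c'))"
    by (simp only: sum_distrib_left)
  also have "(\<Sum>c\<in>Js \<times> Rhos. \<Sum>c'\<in>Js \<times> Rhos. g (snd c) (snd c'))
      = (real (card Js))\<^sup>2 * (\<Sum>\<rho>\<in>Rhos. \<Sum>\<rho>'\<in>Rhos. g \<rho> \<rho>')"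
  proof -
    have fac: "(\<Sum>c\<in>Js \<times> Rhos. f (snd c)) = real (card Js) * (\<Sum>\<rho>\<in>Rhos. f \<rho>)"
      for f :: "('a \<Rightarrow> nat) \<Rightarrow> real"
    proof -
      have "(\<Sum>c\<in>Js \<times> Rhos. f (snd c)) = (\<Sum>j\<in>Js. \<Sum>\<rho>\<in>Rhos. f \<rho>)"
        unfolding sum.cartesian_product by (intro sum.cong) auto
      then show ?thesis by simp
    qed
    have "(\<Sum>c\<in>Js \<times> Rhos. \<Sum>c'\<in>Js \<times> Rhos. g (snd c) (snd c'))
        = (\<Sum>c\<in>Js \<times> Rhos. real (card Js) * (\<Sum>\<rho>'\<in>Rhos. g (snd c) \<rho>'))"
      by (intro sum.cong refl fac)
    also have "\<dots> = real (card Js) * (\<Sum>\<rho>\<in>Rhos. real (card Js) * (\<Sum>\<rho>'\<in>Rhos. g \<rho> \<rho>'))"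
      by (rule fac)
    finally show ?thesis by (simp add: power2_eq_square sum_distrib_left mult.assoc)
  qed
  also have "\<dots> \<le> (real (card Js))\<^sup>2 * ((real (card Rhos))\<^sup>2 * DR)"
    unfolding Rhos_def DR_def g_def using finite_sets blk2 s p
    by (intro mult_left_mono sum_pairs_PiE) (auto simp: block_def)
  finally show ?thesis
    using p by (simp add: card_cartesian_product power_mult_distrib mult.assoc mult_left_mono)
qed

lemma sum_EP_pairs:
  "(\<Sum>\<phi>\<in>Phis. \<Sum>\<phi>'\<in>Phis. p ^ card (EP \<phi> \<union> EP \<phi>'))
    \<le> p ^ (2 * card (EF z)) * ((real (card Phis))\<^sup>2 * DF)"
proof -
  have 1: "p ^ card (EP \<phi> \<union> EP \<phi>')
      \<le> p ^ (2 * card (EF z)) * (\<Prod>y\<in>VF z. if \<phi> y = \<phi>' y then p powr (- m) else 1)"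
    if \<phi>: "\<phi> \<in> Phis" "\<phi>' \<in> Phis" for \<phi> \<phi>'
  proof -
    have "{e\<in>EF z. \<forall>y\<in>e. \<phi> y = \<phi>' y} = {e\<in>EF z. e \<subseteq> {y\<in>VF z. \<phi> y = \<phi>' y}}"
      using EF_edge(1) by blast
    then have "real (card {e\<in>EF z. \<forall>y\<in>e. \<phi> y = \<phi>' y}) \<le> m * real (card {y\<in>VF z. \<phi> y = \<phi>' y})"
      using EF_density[of "{y\<in>VF z. \<phi> y = \<phi>' y}" z] by simp
    then show ?thesis
      unfolding EP_def using \<phi>_props[OF \<phi>(1)] \<phi>_props[OF \<phi>(2)] p EF_edge(1)
      by (intro power_card_Un_images_le[where V = "VF z" and c = blk]) auto
  qed
  have "(\<Sum>\<phi>\<in>Phis. \<Sum>\<phi>'\<in>Phis. p ^ card (EP \<phi> \<union> EP \<phi>'))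
      \<le> (\<Sum>\<phi>\<in>Phis. \<Sum>\<phi>'\<in>Phis.
          p ^ (2 * card (EF z)) * (\<Prod>y\<in>VF z. if \<phi> y = \<phi>' y then p powr (- m) else 1))"
    by (intro sum_mono 1)
  also have "\<dots> = p ^ (2 * card (EF z)) * (\<Sum>\<phi>\<in>Phis. \<Sum>\<phi>'\<in>Phis.
          (\<Prod>y\<in>VF z. if \<phi> y = \<phi>' y then p powr (- m) else 1))"
    by (simp only: sum_distrib_left)
  also have "\<dots> \<le> p ^ (2 * card (EF z)) * ((real (card Phis))\<^sup>2 * DF)"
    unfolding Phis_def DF_def using blk1 s p
    by (intro mult_left_mono sum_pairs_PiE) (auto simp: block_def)
  finally show ?thesis .
qed

text \<open>Distinct extensions yield distinct copies of \<open>H\<close>, because the colours in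
  the image reveal both the labels and the source vertices. All edges of such a copy are in
  \<open>W\<close>: the new ones by assumption, those inside \<open>K\<close> through the planted
  copy.\<close>

lemma card_extensions_le:
  assumes \<phi>: "\<phi> \<in> Phis" and W: "verts W = {1..n}" "edges W \<subseteq> complete_edges n" and EP: "EP \<phi> \<subseteq> edges W"
  shows "card {c\<in>Js \<times> Rhos. EN \<phi> c \<subseteq> edges W} \<le> num_copies H W"
proof -
  let ?C = "{c\<in>Js \<times> Rhos. EN \<phi> c \<subseteq> edges W}"
  have "inj_on (\<lambda>c. image_graph (\<theta> \<phi> c) H) ?C"
  proof (rule inj_onI)
    fix c c' assume c: "c \<in> ?C" "c' \<in> ?C" "image_graph (\<theta> \<phi> c) H = image_graph (\<theta> \<phi> c') H"
    then have cJ: "c \<in> Js \<times> Rhos" "c' \<in> Js \<times> Rhos" by auto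
    have "\<theta> \<phi> c ` verts H = \<theta> \<phi> c' ` verts H" using c(3) by (simp add: image_graph_def)
    from image_eq_left_inverse[OF \<theta>_inverse[OF \<phi> cJ(1)] \<theta>_inverse[OF \<phi> cJ(2)] subset_refl subset_refl this]
    have eq: "\<theta> \<phi> c x = \<theta> \<phi> c' x" if "x \<in> verts H" for x using that by blast
    have "fst c = fst c'"
    proof (rule PiE_ext[of _ I "\<lambda>_. {1..z}"])
      fix i assume i: "i \<in> I"
      \<comment> \<open>Each cover has a vertex outside \<open>U0\<close>, and the colour of its
        image records the label.\<close>
      then obtain x where x: "x \<in> U i" "x \<notin> U0" using U(1) by blast
      have xH: "x \<in> verts H" using x i U(2) by blast
      have "lab (fst c) x = lab (fst c') x"
        using \<theta>_props(2)[OF \<phi> cJ(1) xH] \<theta>_props(2)[OF \<phi> cJ(2) xH] eq[OF xH] by simp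
      then show "fst c i = fst c' i"
        using lab_eq_lift[OF i x(1)] x(2) by (simp add: lift_def)
    qed (use cJ in \<open>auto simp: Js_def\<close>)
    moreover have "snd c = snd c'"
    proof (rule PiE_ext[of _ R "\<lambda>x. block (x, 0)"])
      fix x assume x: "x \<in> R"
      then show "snd c x = snd c' x" using eq[of x] by (auto simp: R_def \<theta>_def)
    qed (use cJ in \<open>auto simp: Rhos_def\<close>)
    ultimately show "c = c'" by (rule prod_eqI)
  qed
  then have "card ?C = card ((\<lambda>c. image_graph (\<theta> \<phi> c) H) ` ?C)"
    by (simp add: card_image)
  also have "\<dots> \<le> card {F \<in> copies H n. edges F \<subseteq> edges W}"
  proof (rule card_mono)
    show "finite {F \<in> copies H n. edges F \<subseteq> edges W}" by (simp add: finite_copies)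
    show "(\<lambda>c. image_graph (\<theta> \<phi> c) H) ` ?C \<subseteq> {F \<in> copies H n. edges F \<subseteq> edges W}"
    proof (rule image_subsetI, rule CollectI, rule conjI)
      fix c assume "c \<in> ?C"
      then have c: "c \<in> Js \<times> Rhos" "EN \<phi> c \<subseteq> edges W" by auto
      show "image_graph (\<theta> \<phi> c) H \<in> copies H n"
        using \<theta>_props(1)[OF \<phi> c(1)] by (intro image_graph_copies H inj_\<theta>[OF \<phi> c(1)]) blast
      have "\<theta> \<phi> c ` e \<in> edges W" if e: "e \<in> edges H" for e
      proof (cases "e \<subseteq> K")
        case False
        then have "\<theta> \<phi> c ` e \<in> EN \<phi> c" using e by (simp add: EN_def new_edges_def)
        then show ?thesis using c by blast
      next
        case True
        then obtain i where i: "i \<in> I" "e \<subseteq> U i" using edges_K[OF e] by (auto simp: K_def)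
        have "\<theta> \<phi> c ` e = \<phi> ` lift (fst c i) ` e"
          unfolding image_image
        proof (rule image_cong[OF refl])
          fix x assume x: "x \<in> e"
          then have "x \<in> K" using True by blast
          then show "\<theta> \<phi> c x = \<phi> (lift (fst c i) x)"
            using lab_eq_lift[OF i(1), of x] i(2) x by (auto simp: \<theta>_def)
        qed
        moreover have "fst c i \<in> {1..z}" using c(1) i(1) by (auto simp: Js_def)
        then have "lift (fst c i) ` e \<in> EF z" using i e unfolding EF_def by blast
        ultimately have "\<theta> \<phi> c ` e \<in> EP \<phi>" unfolding EP_def by blast
        then show ?thesis using EP by blast
      qed
      then show "edges (image_graph (\<theta> \<phi> c) H) \<subseteq> edges W"
        by (auto simp: image_graph_def)
    qed
  qed
  also have "\<dots> = num_copies H W"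
    by (rule num_copies_eq_card[OF W, symmetric])
  finally show ?thesis .
qed

lemma card_families: "card Phis > 0" "card Rhos \<ge> s2 ^ card R" "card Rhos > 0" "card Js = z ^ card I"
proof -
  have "card Phis = (\<Prod>y\<in>VF z. card (block y))"
    by (simp add: Phis_def card_PiE)
  also have "\<dots> > 0"
  proof (rule prod_pos)
    show "0 < card (block y)" if "y \<in> VF z" for y
      using blk1[OF that] s unfolding block_def by linarith
  qed
  finally show "card Phis > 0" .
  have "s2 ^ card R = (\<Prod>x\<in>R. s2)" by simp
  also have "\<dots> \<le> (\<Prod>x\<in>R. card (block (x, 0)))"
    using blk2 by (intro prod_mono) (auto simp: block_def)
  also have "\<dots> = card Rhos"
    using finite_sets by (simp add: Rhos_def card_PiE)
  finally show "card Rhos \<ge> s2 ^ card R" .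
  then show "card Rhos > 0" using s(2) by (metis gr0I le_zero_eq power_eq_0_iff less_irrefl)
  show "card Js = z ^ card I" using I by (simp add: Js_def card_PiE)
qed

text \<open>Paley-Zygmund over the extensions shows that a fixed \<open>\<phi>\<close> is planted
  and has at least \<open>T\<close> extensions with probability at least p^|EF|/(4 DR), where p^|EF|
  is the probability of planting alone. The second moment over all \<open>\<phi>\<close> then bounds
  the probability of the union; squaring the factor 1/(4 DR) gives 16 DR^2.\<close>

lemma upper_tail_ge:
  assumes T: "0 \<le> T" "T \<le> real (z ^ card I) * real (s2 ^ card R) * p ^ card new_edges / 2"
  shows "1 / (16 * DR\<^sup>2 * DF) \<le> upper_tail H n p T"
proof -
  have p': "p \<in> {0..1}" using p by simp
  define N where "N = real (card (Js \<times> Rhos))"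
  have N: "N > 0" "T \<le> N * p ^ card new_edges / 2"
  proof -
    have "N = real (z ^ card I) * real (card Rhos)"
      using card_families(4) by (simp add: N_def card_cartesian_product)
    moreover have "real (s2 ^ card R) \<le> real (card Rhos)" using card_families(2) by (rule of_nat_mono)
    ultimately have "real (z ^ card I) * real (s2 ^ card R) * p ^ card new_edges \<le> N * p ^ card new_edges"
      using p by (auto intro!: mult_mono)
    then show "T \<le> N * p ^ card new_edges / 2" using T by linarith
    show "N > 0" using card_families(3,4) z by (simp add: N_def card_cartesian_product)
  qed
  define B where "B = (\<lambda>\<phi> W. EP \<phi> \<subseteq> edges W \<and> T \<le> real (card {c\<in>Js \<times> Rhos. EN \<phi> c \<subseteq> edges W}))"
  define P where "P = (\<lambda>X. measure_pmf.prob (Gnp n p) {W. X W})"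
  have 1: "p ^ card (EF z) / (4 * DR) \<le> P (B \<phi>)" if \<phi>: "\<phi> \<in> Phis" for \<phi>
  proof -
    have sum: "(\<Sum>c\<in>Js \<times> Rhos. p ^ card (EP \<phi> \<union> EN \<phi> c)) = N * p ^ (card (EF z) + card new_edges)"
      using card_EP_EN(1)[OF \<phi>] by (simp add: N_def)
    have "T * p ^ card (EP \<phi>) \<le> N * p ^ card new_edges / 2 * p ^ card (EF z)"
      using N(2) p card_EP[OF \<phi>] by (simp add: mult_right_mono)
    then have "T * p ^ card (EP \<phi>) \<le> (\<Sum>c\<in>Js \<times> Rhos. p ^ card (EP \<phi> \<union> EN \<phi> c)) / 2"
      unfolding sum by (simp add: power_add mult_ac)
    from Paley_Zygmund_edges[OF p' EP_complete[OF \<phi>] finite_families(4) EN_complete[OF \<phi>] T(1) this]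
    have "(N * p ^ (card (EF z) + card new_edges))\<^sup>2 / 4
      \<le> P (B \<phi>) * (\<Sum>c\<in>Js \<times> Rhos. \<Sum>c'\<in>Js \<times> Rhos. p ^ card (EP \<phi> \<union> EN \<phi> c \<union> EN \<phi> c'))"
      unfolding sum P_def B_def .
    also have "(\<Sum>c\<in>Js \<times> Rhos. \<Sum>c'\<in>Js \<times> Rhos. p ^ card (EP \<phi> \<union> EN \<phi> c \<union> EN \<phi> c'))
      = p ^ card (EF z) * (\<Sum>c\<in>Js \<times> Rhos. \<Sum>c'\<in>Js \<times> Rhos. p ^ card (EN \<phi> c \<union> EN \<phi> c'))"
      unfolding sum_distrib_left by (intro sum.cong refl) (simp only: card_EP_EN(2)[OF \<phi>] power_add)
    also have "\<dots> \<le> p ^ card (EF z) * (p ^ (2 * card new_edges) * (N\<^sup>2 * DR))"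
      using sum_EN_pairs[OF \<phi>] p unfolding N_def by (intro mult_left_mono) auto
    finally have "(N * p ^ (card (EF z) + card new_edges))\<^sup>2 / 4
      \<le> P (B \<phi>) * (p ^ card (EF z) * (p ^ (2 * card new_edges) * (N\<^sup>2 * DR)))"
      by (simp add: P_def mult_left_mono)
    then have "p ^ card (EF z) * (N\<^sup>2 * p ^ (2 * card new_edges) * p ^ card (EF z))
      \<le> P (B \<phi>) * (4 * DR) * (N\<^sup>2 * p ^ (2 * card new_edges) * p ^ card (EF z))"
      by (simp add: power2_eq_square power_add mult_2 mult_ac)
    then have "p ^ card (EF z) \<le> P (B \<phi>) * (4 * DR)"
      by (rule mult_right_le_imp_le) (use N(1) p in auto)
    then show ?thesis using DR_pos by (simp add: divide_le_eq)
  qed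
  define M where "M = real (card Phis)"
  have M: "M > 0" using card_families(1) by (simp add: M_def)
  have "M * (p ^ card (EF z) / (4 * DR)) = (\<Sum>\<phi>\<in>Phis. p ^ card (EF z) / (4 * DR))"
    by (simp add: M_def)
  also have "\<dots> \<le> (\<Sum>\<phi>\<in>Phis. P (B \<phi>))"
    by (intro sum_mono 1)
  finally have "(M * (p ^ card (EF z) / (4 * DR)))\<^sup>2 \<le> (\<Sum>\<phi>\<in>Phis. P (B \<phi>))\<^sup>2"
    using p DR_pos M by (intro power_mono) auto
  also have "\<dots> \<le> P (\<lambda>W. \<exists>\<phi>\<in>Phis. B \<phi> W) * (\<Sum>\<phi>\<in>Phis. \<Sum>\<phi>'\<in>Phis. p ^ card (EP \<phi> \<union> EP \<phi>'))"
    unfolding P_def using EP_complete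
    by (intro second_moment_Union p' finite_families) (auto simp: B_def)
  also have "\<dots> \<le> P (\<lambda>W. \<exists>\<phi>\<in>Phis. B \<phi> W) * (p ^ (2 * card (EF z)) * (M\<^sup>2 * DF))"
    unfolding M_def using sum_EP_pairs by (intro mult_left_mono) (auto simp: P_def)
  finally have "1 * (M\<^sup>2 * p ^ (2 * card (EF z))) \<le> P (\<lambda>W. \<exists>\<phi>\<in>Phis. B \<phi> W) * (16 * DR\<^sup>2 * DF) * (M\<^sup>2 * p ^ (2 * card (EF z)))"
    using DR_pos by (simp add: power_mult_distrib power_divide field_simps flip: power_mult)
  then have "1 \<le> P (\<lambda>W. \<exists>\<phi>\<in>Phis. B \<phi> W) * (16 * DR\<^sup>2 * DF)"
    by (rule mult_right_le_imp_le) (use M p in auto)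
  then have "1 / (16 * DR\<^sup>2 * DF) \<le> P (\<lambda>W. \<exists>\<phi>\<in>Phis. B \<phi> W)"
    using DR_pos DF_pos by (simp add: divide_le_eq)
  also have "\<dots> \<le> upper_tail H n p T"
    unfolding P_def upper_tail_def
  proof (rule measure_pmf.finite_measure_mono_AE)
    show "AE W in measure_pmf (Gnp n p). W \<in> {W. \<exists>\<phi>\<in>Phis. B \<phi> W} \<longrightarrow> W \<in> {W. T \<le> real (num_copies H W)}"
      unfolding AE_measure_pmf_iff
    proof (intro ballI impI)
      fix W assume W: "W \<in> set_pmf (Gnp n p)" "W \<in> {W. \<exists>\<phi>\<in>Phis. B \<phi> W}"
      then obtain \<phi> where \<phi>: "\<phi> \<in> Phis" "EP \<phi> \<subseteq> edges W"
        "T \<le> real (card {c\<in>Js \<times> Rhos. EN \<phi> c \<subseteq> edges W})" by (auto simp: B_def)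
      have "card {c\<in>Js \<times> Rhos. EN \<phi> c \<subseteq> edges W} \<le> num_copies H W"
        using set_Gnp[OF W(1)] \<phi> by (intro card_extensions_le) auto
      then show "W \<in> {W. T \<le> real (num_copies H W)}" using \<phi>(3) by simp
    qed
  qed simp
  finally show ?thesis .
qed

end

section \<open>The upper tail of the planted graph\<close>

text \<open>With x = \<omega> and B x^k + 1 as an upper bound for z, the left side bounds the
  logarithm of the reciprocal planting probability; the gap between k and k' absorbs its logarithmic
  factor.\<close>

lemma ln_growth:
  fixes k k' B v C :: real
  assumes "0 < k" "k < k'" "0 < B" "0 < v"
  shows "eventually (\<lambda>x. C + v * (B * x powr k + 1) * ln (1 + 4 * v * (B * x powr k + 1)) \<le> x powr k') at_top"
  using assms by real_asymp

context blowup
begin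

definition edge_scale :: "nat \<Rightarrow> real \<Rightarrow> real" where
  "edge_scale n p = real n * p powr m"

text \<open>Half of \<open>{1..n}\<close> serves the at most v z planted vertices, in blocks of size
  n/(2vz), and half serves the at most v vertices of \<open>R\<close>, in blocks of size n/(2v),
  where v is the order of \<open>H\<close>.\<close>

lemma ex_planting:
  assumes p: "0 < p" "p \<le> 1" and z: "z \<ge> 1" and n: "2 * nverts H * z \<le> n"
  shows "\<exists>blk. planting H I U0 U m n z (n div (2 * nverts H * z)) (n div (2 * nverts H)) p blk"
proof -
  let ?v = "nverts H"
  define s1 where "s1 = n div (2 * ?v * z)"
  define s2 where "s2 = n div (2 * ?v)"
  have v: "?v > 0"
    using I(2) U fin(1) by (auto simp: card_gt_0_iff)
  have "2 * ?v \<le> 2 * ?v * z" using z by simp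
  then have n': "2 * ?v \<le> n" using n by linarith
  have s: "s1 > 0" "s2 > 0"
    using n n' v z unfolding s1_def s2_def by (simp_all add: div_greater_zero_iff)
  let ?Y = "VF z \<union> R \<times> {0}"
  have disj: "VF z \<inter> R \<times> {0} = {}"
    by (auto simp: VF_def lift_def R_def K_def)
  have finY: "finite (VF z)" "finite (R \<times> {0::nat})" using finite_sets by auto
  define w where "w = (\<lambda>y. if y \<in> VF z then s1 else s2)"
  have "sum w ?Y = sum w (VF z) + sum w (R \<times> {0})"
    using finY disj by (rule sum.union_disjoint)
  also have "sum w (VF z) = card (VF z) * s1" by (simp add: w_def)
  also have "sum w (R \<times> {0}) = (\<Sum>y\<in>R \<times> {0::nat}. s2)"
  proof (rule sum.cong[OF refl])
    fix y assume "y \<in> R \<times> {0::nat}"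
    then have "y \<notin> VF z" using disj by blast
    then show "w y = s2" by (simp add: w_def)
  qed
  also have "\<dots> = card R * s2" by (simp add: card_cartesian_product)
  also have "card (VF z) * s1 \<le> ?v * z * s1" using card_VF_le[OF z] by simp
  also have "card R * s2 \<le> ?v * s2"
    using fin(1) by (intro mult_right_mono card_mono) (auto simp: R_def)
  finally have "sum w ?Y \<le> ?v * z * s1 + ?v * s2" by simp
  moreover have "2 * ?v * z * s1 \<le> n" "2 * ?v * s2 \<le> n"
    unfolding s1_def s2_def by (rule times_div_less_eq_dividend)+
  ultimately have "sum w ?Y \<le> card {1..n}" by simp
  then obtain blk where blk: "\<forall>y\<in>?Y. w y \<le> card {v\<in>{1..n}. blk v = y}"
    using ex_coloring[of ?Y "{1..n}" w] finY by blast
  have "planting H I U0 U m n z s1 s2 p blk"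
  proof unfold_locales
    show "s1 \<le> card {v \<in> {1..n}. blk v = y}" if "y \<in> VF z" for y
    proof -
      have "w y \<le> card {v \<in> {1..n}. blk v = y}" using blk that by blast
      then show ?thesis unfolding w_def if_P[OF that] .
    qed
    show "s2 \<le> card {v \<in> {1..n}. blk v = (x, 0)}" if "x \<in> R" for x
    proof -
      have notin: "(x, 0) \<notin> VF z" using disj that by blast
      have "w (x, 0) \<le> card {v \<in> {1..n}. blk v = (x, 0)}" using blk that by blast
      then show ?thesis unfolding w_def if_not_P[OF notin] .
    qed
  qed (use p z s in auto)
  then show ?thesis unfolding s1_def s2_def by blast
qed

lemma card_verts_split: "nverts H = card K + card R"
  using K_subset fin(1) finite_sets(1) by (simp add: R_def card_Diff_subset card_mono)

lemma card_edges_split: "nedges H = card (edges_on H K) + card new_edges"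
proof -
  have "card (edges_on H K \<union> new_edges) = card (edges_on H K) + card new_edges"
    using fin(2) by (intro card_Un_disjoint) (auto simp: new_edges_def)
  moreover have "edges_on H K \<union> new_edges = edges H" by (auto simp: new_edges_def)
  ultimately show ?thesis by simp
qed

text \<open>The block sizes give p^(-m)/s2 \<le> 4v/\<omega> \<le> 1, so \<open>DR\<close> is
  bounded, and p^(-m)/s1 \<le> 4vz/\<omega> \<le> 4vz, whence the base 1 + 4vz. In the condition on
  z the factor 2 comes from asking for half of the expected number of extensions, and (4v)^v from
  the size of the blocks of \<open>R\<close>.\<close>

lemma upper_tail_blowup_ge:
  assumes p: "0 < p" "p \<le> 1" and z: "z \<ge> 1" and n: "2 * nverts H * z \<le> n"
    and \<omega>: "4 * real (nverts H) \<le> edge_scale n p"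
    and A: "0 \<le> A" "2 * A * (4 * real (nverts H)) ^ nverts H * edge_scale n p ^ card K \<le> real z ^ card I"
  shows "1 / (16 * 4 ^ nverts H * (1 + 4 * real (nverts H) * real z) ^ (nverts H * z))
    \<le> upper_tail H n p (A * mu_copies H n p)"
proof -
  let ?v = "nverts H" and ?\<omega> = "edge_scale n p"
  obtain blk where "planting H I U0 U m n z (n div (2 * ?v * z)) (n div (2 * ?v)) p blk"
    using ex_planting[OF p z n] by blast
  then interpret planting H I U0 U m n z "n div (2 * ?v * z)" "n div (2 * ?v)" p blk .
  have v: "?v \<ge> 1"
    using I(2) U fin(1) by (auto simp: Suc_le_eq card_gt_0_iff)
  have "2 * ?v \<le> 2 * ?v * z" using z by simp
  then have n': "2 * ?v \<le> n" using n by linarith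
  have \<omega>1: "?\<omega> \<ge> 1" using \<omega> v by linarith
  have pm: "p powr m > 0" using p by simp
  have s1: "real n / (4 * real ?v * real z) \<le> real (n div (2 * ?v * z))"
    using real_div_ge[of "2 * ?v * z" n] n v z by (simp add: mult_ac)
  have s2: "real n / (4 * real ?v) \<le> real (n div (2 * ?v))"
    using real_div_ge[of "2 * ?v" n] n' v by simp
  have npos: "real n > 0" using n' v by simp
  have inv_le: "p powr (- m) / real s \<le> 4 * c / ?\<omega>" if "real n / (4 * c) \<le> real s" "c > 0" for s c
  proof -
    have "0 < real n / (4 * c)" using npos that(2) by simp
    then have "p powr (- m) / real s \<le> p powr (- m) / (real n / (4 * c))"
      using that(1) by (intro divide_left_mono mult_pos_pos) (linarith | simp)+
    also have "\<dots> = 4 * c / ?\<omega>"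
      using npos pm that(2) by (simp add: edge_scale_def powr_minus field_simps)
    finally show ?thesis .
  qed
  have "p powr (- m) / real (n div (2 * ?v)) \<le> 4 * real ?v / ?\<omega>"
    using inv_le[OF s2] v by simp
  also have "\<dots> \<le> 1" using \<omega> \<omega>1 by simp
  finally have "DR \<le> 2 ^ card R"
    unfolding DR_def by (intro power_mono) auto
  also have "(2::real) ^ card R \<le> 2 ^ ?v"
    using card_verts_split by (intro power_increasing) auto
  finally have "DR\<^sup>2 \<le> (2 ^ ?v)\<^sup>2"
    using DR_pos by (intro power_mono) auto
  also have "(2 ^ ?v)\<^sup>2 = (4::real) ^ ?v"
    by (simp add: power2_eq_square flip: power_mult_distrib)
  finally have DR: "DR\<^sup>2 \<le> 4 ^ ?v" .
  have "p powr (- m) / real (n div (2 * ?v * z)) \<le> 4 * (real ?v * real z) / ?\<omega>"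
    using inv_le[of "real ?v * real z" "n div (2 * ?v * z)"] s1 v z by (simp add: mult.assoc)
  also have "\<dots> \<le> 4 * (real ?v * real z)"
    using \<omega>1 v z by (simp add: divide_le_eq)
  finally have "DF \<le> (1 + 4 * real ?v * real z) ^ card (VF z)"
    unfolding DF_def by (intro power_mono) (auto simp: mult.assoc)
  also have "\<dots> \<le> (1 + 4 * real ?v * real z) ^ (?v * z)"
    using card_VF_le[OF z] by (intro power_increasing) auto
  finally have DF: "DF \<le> (1 + 4 * real ?v * real z) ^ (?v * z)" .
  have "A * mu_copies H n p \<le> A * (real n ^ ?v * p ^ nedges H)"
    using mu_copies_le[OF H, of p n] p A(1) by (intro mult_left_mono) auto
  \<comment> \<open>Tightness of \<open>K\<close> turns its share of the expected count into
    \<omega>^|K|; the rest is the expected number of ways to place \<open>R\<close>, up to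
    constants.\<close>
  also have "real n ^ ?v * p ^ nedges H = ?\<omega> ^ card K * (real n ^ card R * p ^ card new_edges)"
  proof -
    have "p ^ card (edges_on H K) = p powr (m * real (card K))"
      using p tightK by (simp add: K_def flip: powr_realpow)
    also have "\<dots> = (p powr m) ^ card K"
      using pm by (simp add: powr_powr flip: powr_realpow)
    finally show ?thesis
      unfolding card_verts_split card_edges_split edge_scale_def by (simp add: power_add power_mult_distrib)
  qed
  also have "A * (?\<omega> ^ card K * (real n ^ card R * p ^ card new_edges))
      = (2 * A * (4 * real ?v) ^ ?v * ?\<omega> ^ card K) * ((real n ^ card R / (4 * real ?v) ^ ?v) * p ^ card new_edges) / 2"
    using v by simp
  also have "\<dots> \<le> real z ^ card I * (real (n div (2 * ?v)) ^ card R * p ^ card new_edges) / 2"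
  proof -
    have "real n ^ card R / (4 * real ?v) ^ ?v \<le> real n ^ card R / (4 * real ?v) ^ card R"
      using v card_verts_split by (intro divide_left_mono power_increasing) auto
    also have "\<dots> = (real n / (4 * real ?v)) ^ card R" by (simp add: power_divide)
    also have "\<dots> \<le> real (n div (2 * ?v)) ^ card R"
      using s2 by (intro power_mono) auto
    finally show ?thesis
      using A p by (intro divide_right_mono mult_mono) auto
  qed
  also have "\<dots> = real (z ^ card I) * real ((n div (2 * ?v)) ^ card R) * p ^ card new_edges / 2"
    by simp
  finally have T: "A * mu_copies H n p \<le> \<dots>" .
  have T0: "0 \<le> A * mu_copies H n p"
    using A(1) p mu_copies_eq[OF H, of p n] by simp
  have "1 / (16 * 4 ^ ?v * (1 + 4 * real ?v * real z) ^ (?v * z)) \<le> 1 / (16 * DR\<^sup>2 * DF)"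
    using DR DF DR_pos DF_pos by (intro divide_left_mono mult_mono mult_pos_pos) auto
  also have "\<dots> \<le> upper_tail H n p (A * mu_copies H n p)"
    by (rule upper_tail_ge[OF T0 T])
  finally show ?thesis .
qed

text \<open>The choice is z = \<lceil>B \<omega>^k\<rceil> with k = |K|/|I| and B^|I| = C, so z^|I|
  reaches C \<omega>^|K|. Since k is at most the order of \<open>H\<close>, the upper bound on
  \<omega> makes z of order at most sqrt n and the planted graph fits.\<close>

lemma eventually_upper_tail_ge:
  assumes p: "\<And>n. p n \<in> {0..1}"
    and \<omega>: "filterlim (\<lambda>n. edge_scale n (p n)) at_top sequentially"
    and \<omega>_le: "\<forall>\<^sub>F n in sequentially. edge_scale n (p n) \<le> real n powr (1 / (2 * real (nverts H)))"
    and k': "real (card K) / real (card I) < k'" and A: "0 \<le> A"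
  shows "\<forall>\<^sub>F n in sequentially. exp (- (edge_scale n (p n) powr k')) \<le> upper_tail H n (p n) (A * mu_copies H n (p n))"
proof -
  let ?v = "nverts H"
  define k where "k = real (card K) / real (card I)"
  have Ipos: "card I > 0" using I by (simp add: card_gt_0_iff)
  have Kpos: "card K > 0"
    using I(2) U(1) finite_sets(1) by (auto simp: card_gt_0_iff K_def)
  have k: "0 < k" "k \<le> real ?v" "k < k'"
  proof -
    show "0 < k" "k < k'" using Ipos Kpos k' by (simp_all add: k_def)
    have "k \<le> real (card K) / 1"
      unfolding k_def using Ipos by (intro divide_left_mono) auto
    then have "k \<le> real (card K)" by simp
    also have "\<dots> \<le> real ?v" using card_verts_split by simp
    finally show "k \<le> real ?v" .
  qed
  have v: "real ?v > 0" using k by linarith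
  \<comment> \<open>The summand 1 keeps \<open>C\<close>, and with it \<open>B\<close>, positive
    when \<open>A = 0\<close>.\<close>
  define C where "C = 2 * A * (4 * real ?v) ^ ?v + 1"
  have C: "C \<ge> 1" using A by (simp add: C_def)
  define B where "B = C powr (1 / real (card I))"
  have B: "B > 0" using C by (simp add: B_def)
  have ev1: "\<forall>\<^sub>F n in sequentially. edge_scale n (p n) \<ge> max 1 (4 * real ?v)"
    using \<omega> unfolding filterlim_at_top by blast
  have ev2: "\<forall>\<^sub>F n in sequentially. ln (16 * 4 ^ ?v) +
      real ?v * (B * edge_scale n (p n) powr k + 1) * ln (1 + 4 * real ?v * (B * edge_scale n (p n) powr k + 1))
      \<le> edge_scale n (p n) powr k'"
    by (rule eventually_compose_filterlim[OF ln_growth \<omega>]) (use k B v in auto)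
  have ev3: "\<forall>\<^sub>F n::nat in sequentially. 2 * real ?v * (B * sqrt n + 1) \<le> n"
    by real_asymp
  show ?thesis
    using ev1 ev2 ev3 \<omega>_le eventually_ge_at_top[of 1]
  proof eventually_elim
    case (elim n)
    let ?\<omega> = "edge_scale n (p n)"
    have \<omega>1: "?\<omega> \<ge> 1" "4 * real ?v \<le> ?\<omega>" using elim(1) by auto
    have pn: "0 < p n" "p n \<le> 1"
    proof -
      have "p n \<noteq> 0" using \<omega>1(1) by (auto simp: edge_scale_def)
      then show "0 < p n" "p n \<le> 1" using p[of n] by auto
    qed
    define z where "z = nat \<lceil>B * ?\<omega> powr k\<rceil>"
    have Bk: "B * ?\<omega> powr k > 0" using B \<omega>1 by simp
    have z_ge: "B * ?\<omega> powr k \<le> real z" and z_le: "real z \<le> B * ?\<omega> powr k + 1"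
      unfolding z_def using Bk by linarith+
    have z: "z \<ge> 1" using z_ge Bk by linarith
    have "?\<omega> powr k \<le> (real n powr (1 / (2 * real ?v))) powr k"
      using \<omega>1 k elim by (intro powr_mono2) auto
    also have "\<dots> = real n powr (k / (2 * real ?v))" by (simp add: powr_powr)
    also have "\<dots> \<le> real n powr (1/2)"
      using k v elim by (intro powr_mono) (auto simp: divide_le_eq)
    finally have "?\<omega> powr k \<le> sqrt (real n)" by (simp add: powr_half_sqrt)
    then have "B * ?\<omega> powr k + 1 \<le> B * sqrt (real n) + 1" using B by simp
    then have "2 * real ?v * real z \<le> 2 * real ?v * (B * sqrt n + 1)"
      using z_le v by (intro mult_left_mono) linarith+
    also have "\<dots> \<le> real n" using elim by simp
    finally have "real (2 * ?v * z) \<le> real n" by simp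
    then have n: "2 * ?v * z \<le> n" by (simp only: of_nat_le_iff)
    have "2 * A * (4 * real ?v) ^ ?v * ?\<omega> ^ card K \<le> C * ?\<omega> ^ card K"
      using \<omega>1 by (intro mult_right_mono) (auto simp: C_def)
    also have "\<dots> = (B * ?\<omega> powr k) ^ card I"
    proof -
      have "B ^ card I = C"
        using C Ipos by (simp add: B_def powr_powr flip: powr_realpow)
      moreover have "(?\<omega> powr k) ^ card I = ?\<omega> ^ card K"
        using \<omega>1 Ipos by (simp add: k_def powr_powr flip: powr_realpow)
      ultimately show ?thesis by (simp add: power_mult_distrib)
    qed
    also have "\<dots> \<le> real z ^ card I" using z_ge Bk by (intro power_mono) auto
    finally have "1 / (16 * 4 ^ ?v * (1 + 4 * real ?v * real z) ^ (?v * z)) \<le> upper_tail H n (p n) (A * mu_copies H n (p n))"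
      by (intro upper_tail_blowup_ge pn z n \<omega>1(2) A)
    moreover have "exp (- (?\<omega> powr k')) \<le> 1 / (16 * 4 ^ ?v * (1 + 4 * real ?v * real z) ^ (?v * z))"
    proof -
      have pos: "1 + 4 * real ?v * real z > 0" using v by (intro add_pos_nonneg) auto
      have "ln (16 * 4 ^ ?v * (1 + 4 * real ?v * real z) ^ (?v * z))
          = ln (16 * 4 ^ ?v) + real ?v * real z * ln (1 + 4 * real ?v * real z)"
        using pos by (simp add: ln_mult ln_realpow)
      also have "real ?v * real z * ln (1 + 4 * real ?v * real z)
          \<le> real ?v * (B * ?\<omega> powr k + 1) * ln (1 + 4 * real ?v * (B * ?\<omega> powr k + 1))"
        using z_le v pos Bk by (intro mult_mono ln_mono mult_left_mono add_left_mono) auto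
      finally have "ln (16 * 4 ^ ?v * (1 + 4 * real ?v * real z) ^ (?v * z)) \<le> ?\<omega> powr k'"
        using elim(2) by linarith
      then have "exp (ln (16 * 4 ^ ?v * (1 + 4 * real ?v * real z) ^ (?v * z))) \<le> exp (?\<omega> powr k')"
        by (simp only: exp_le_cancel_iff)
      moreover have X: "16 * 4 ^ ?v * (1 + 4 * real ?v * real z) ^ (?v * z) > 0"
        using pos by simp
      ultimately have "16 * 4 ^ ?v * (1 + 4 * real ?v * real z) ^ (?v * z) \<le> exp (?\<omega> powr k')"
        by (simp only: exp_ln)
      then show ?thesis
        unfolding exp_minus using X by (simp only: inverse_eq_divide[symmetric] le_imp_inverse_le)
    qed
    ultimately show ?case by linarith
  qed
qed

end

section \<open>Covers of a primal subgraph\<close>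

lemma primal_eqI:
  assumes "simple_graph H" "A \<in> primal H" "B \<in> primal H" "verts A = verts B"
  shows "A = B"
  using primal_edges[OF assms(1,2)] primal_edges[OF assms(1,3)] assms(4) by (simp add: prod_eq_iff)

lemma primal_subgraph:
  assumes "simple_graph H" "A \<in> primal H" "B \<in> primal H" "verts A \<subseteq> verts B"
  shows "subgraph A B"
proof -
  have "edges_on H (verts A) \<subseteq> edges_on H (verts B)" using assms(4) by blast
  then have "edges A \<subseteq> edges B"
    by (simp only: primal_edges[OF assms(1,2)] primal_edges[OF assms(1,3)])
  moreover have "simple_graph A" using assms(2) by (simp add: primal_iff subgraph_def)
  ultimately show ?thesis using assms(4) by (simp add: subgraph_def)
qed

text \<open>Induction with \<open>primal_Un_Int\<close>; the common vertex \<open>x\<close> is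
  carried along so that the intersection at each step is nonempty.\<close>

lemma primal_graph_Union:
  assumes H: "simple_graph H" and I: "finite I" "I \<noteq> {}"
    and J: "\<And>i. i \<in> I \<Longrightarrow> J i \<in> primal H" "\<And>i. i \<in> I \<Longrightarrow> x \<in> verts (J i)"
  shows "graph_Union (J ` I) \<in> primal H \<and> x \<in> verts (graph_Union (J ` I))"
  using I J
proof (induction I rule: finite_ne_induct)
  case (insert i I)
  have IH: "graph_Union (J ` I) \<in> primal H" "x \<in> verts (graph_Union (J ` I))"
    using insert by auto
  have eq: "graph_Union (J ` insert i I) = (verts (J i) \<union> verts (graph_Union (J ` I)), edges (J i) \<union> edges (graph_Union (J ` I)))"
    by (simp add: graph_Union_def)
  have "verts (J i) \<inter> verts (graph_Union (J ` I)) \<noteq> {}" using IH(2) insert.prems(2)[of i] by blast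
  then show ?case
    unfolding eq using primal_Un_Int(1)[OF H insert.prems(1)[OF insertI1] IH(1)] IH(2) by simp
qed (simp add: graph_Union_def)

text \<open>Two distinct covers intersect in a primal graph containing \<open>G\<close>. Were it
  larger than \<open>G\<close>, it would lie strictly between \<open>G\<close> and one of the
  covers, or one cover would lie strictly between \<open>G\<close> and the other. The union of the
  covers is primal, hence induced, so every edge of \<open>H\<close> inside it comes from a single
  cover.\<close>

lemma covers_blowup:
  assumes H: "simple_graph H" "nedges H \<ge> 1" and G: "G \<in> primal H"
    and I: "finite I" "I \<noteq> {}" and inj: "inj_on J I"
    and J: "\<And>i. i \<in> I \<Longrightarrow> J i \<in> primal H" "\<And>i. i \<in> I \<Longrightarrow> covers H (J i) G"
  shows "blowup H I (verts G) (\<lambda>i. verts (J i)) (max_density H)"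
proof -
  have sub: "subgraph G (J i)" "G \<noteq> J i" if "i \<in> I" for i
    using J(2)[OF that] by (auto simp: covers_def proper_subgraph_def)
  have GJ: "verts G \<subset> verts (J i)" if i: "i \<in> I" for i
    using sub[OF i] primal_eqI[OF H(1) G J(1)[OF i]] by (auto simp: subgraph_def)
  obtain x where x: "x \<in> verts G"
    using G by (fastforce simp: primal_iff)
  have xJ: "x \<in> verts (J i)" if "i \<in> I" for i using GJ[OF that] x by blast
  have tight: "real (card (edges_on H (verts F))) = max_density H * real (card (verts F))" if "F \<in> primal H" for F
    using primal_edges[OF H(1) that] that by (simp add: primal_iff)
  have subset: "verts F \<subseteq> verts H" if "F \<in> primal H" for F
    using that by (simp add: primal_iff subgraph_def)
  let ?K = "graph_Union (J ` I)"
  have K: "?K \<in> primal H"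
    using primal_graph_Union[OF H(1) I, of J x] J(1) xJ by blast
  have vK: "verts ?K = (\<Union>i\<in>I. verts (J i))" and eK: "edges ?K = (\<Union>i\<in>I. edges (J i))"
    by (simp_all add: graph_Union_def)
  show ?thesis
  proof
    show "0 < max_density H" by (rule max_density_pos[OF H])
    show "real (card (edges_on H S)) \<le> max_density H * real (card S)" if "S \<subseteq> verts H" for S
      by (rule card_edges_on_le[OF H(1) that])
    show "verts (J i) \<inter> verts (J j) = verts G" if ij: "i \<in> I" "j \<in> I" "i \<noteq> j" for i j
    proof (rule ccontr)
      assume ne: "verts (J i) \<inter> verts (J j) \<noteq> verts G"
      define D where "D = (verts (J i) \<inter> verts (J j), edges (J i) \<inter> edges (J j))"
      have vD: "verts D = verts (J i) \<inter> verts (J j)" by (simp add: D_def)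
      have "verts (J i) \<inter> verts (J j) \<noteq> {}" using xJ ij by blast
      then have D: "D \<in> primal H"
        unfolding D_def by (intro primal_Un_Int(2) H(1) J(1) ij(1,2))
      have GD: "proper_subgraph G D"
        using primal_subgraph[OF H(1) G D] GJ ij ne vD unfolding proper_subgraph_def by blast
      show False
      proof (cases "D = J i")
        case True
        then have "verts (J i) \<subseteq> verts (J j)" using vD by auto
        then have "subgraph (J i) (J j)" by (intro primal_subgraph[OF H(1)] J(1) ij(1,2))
        moreover have "J i \<noteq> J j" using inj ij by (auto dest: inj_onD)
        ultimately have "proper_subgraph (J i) (J j)" by (simp add: proper_subgraph_def)
        moreover have "proper_subgraph G (J i)" using GD True by simp
        ultimately show False using J(2)[OF ij(2)] J(1)[OF ij(1)] unfolding covers_def by blast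
      next
        case False
        have "subgraph D (J i)" using vD by (intro primal_subgraph[OF H(1) D] J(1) ij(1)) simp
        then have "proper_subgraph D (J i)" using False by (simp add: proper_subgraph_def)
        then show False using J(2)[OF ij(1)] D GD unfolding covers_def by blast
      qed
    qed
    show "\<exists>i\<in>I. e \<subseteq> verts (J i)" if "e \<in> edges H" "e \<subseteq> (\<Union>i\<in>I. verts (J i))" for e
    proof -
      have "e \<in> edges ?K" using that primal_edges[OF H(1) K] unfolding vK by blast
      then obtain i where "i \<in> I" "e \<in> edges (J i)" unfolding eK by blast
      then show ?thesis using primal_edges[OF H(1) J(1)] by blast
    qed
  qed (use H I GJ subset J tight[OF G] tight[OF K] vK in auto)
qed

section \<open>Expected counts of subgraphs\<close>

lemma subgraph_verts_pos:
  assumes "simple_graph H" "subgraph D H" "nedges D \<ge> 1"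
  shows "nverts D \<ge> 1"
proof (rule ccontr)
  assume "\<not> nverts D \<ge> 1"
  then have "nverts D = 0" by simp
  then show False using subgraph_density[OF assms(1,2)] assms(3) by simp
qed

lemma primal_gap:
  assumes H: "simple_graph H"
  shows "\<exists>g>0. \<forall>D. subgraph D H \<and> nverts D \<ge> 1 \<and> D \<notin> primal H \<longrightarrow>
    real (nedges D) + g \<le> max_density H * real (nverts D)"
proof -
  let ?S = "{D. subgraph D H \<and> nverts D \<ge> 1 \<and> D \<notin> primal H}"
  define d where "d = (\<lambda>D :: 'a ugraph. max_density H * real (nverts D) - real (nedges D))"
  have finS: "finite ?S" using finite_subgraphs[OF H] by (rule rev_finite_subset) blast
  have "d D > 0" if "D \<in> ?S" for D
    using that subgraph_density[OF H, of D] unfolding primal_iff d_def by force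
  \<comment> \<open>The element 1 makes the minimum meaningful when no non-primal subgraph
    exists.\<close>
  then have "Min (insert 1 (d ` ?S)) > 0"
    using finS by (subst Min_gr_iff) auto
  moreover have "Min (insert 1 (d ` ?S)) \<le> d D" if "D \<in> ?S" for D
    using that finS by (intro Min_le) auto
  ultimately show ?thesis
    unfolding d_def by (intro exI[of _ "Min (insert 1 (d ` ?S))"]) (force simp: d_def)
qed

text \<open>Write n^v p^e = \<omega>^v p^(e - m v). For primal \<open>D\<close> the second factor is
  1 and v is at least the least order k. For other \<open>D\<close> that factor is at least p^(-g),
  a positive power of n, which beats \<omega>^k.\<close>

lemma expected_embeddings_ge:
  assumes H: "simple_graph H" "nedges H \<ge> 1"
  shows "\<exists>\<beta>>0. \<forall>n p D. 0 < p \<longrightarrow> p \<le> 1 \<longrightarrow> n \<ge> 1 \<longrightarrow> 1 \<le> real n * p powr max_density H \<longrightarrow>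
    real n * p powr max_density H \<le> real n powr \<beta> \<longrightarrow> subgraph D H \<longrightarrow> nedges D \<ge> 1 \<longrightarrow>
    (real n * p powr max_density H) powr real (Min (nverts ` primal H)) \<le> real n ^ nverts D * p ^ nedges D"
proof -
  define m where "m = max_density H"
  define k where "k = Min (nverts ` primal H)"
  have m: "m > 0" using max_density_pos[OF H] by (simp add: m_def)
  have k_le: "k \<le> nverts D" if "D \<in> primal H" for D
    using that primal_nonempty[OF H] by (simp add: k_def)
  have "k \<in> nverts ` primal H"
    using primal_nonempty[OF H] by (simp add: k_def)
  then have k: "k \<ge> 1" by (auto simp: primal_iff)
  obtain g where g: "g > 0" "\<And>D. subgraph D H \<Longrightarrow> nverts D \<ge> 1 \<Longrightarrow> D \<notin> primal H \<Longrightarrow>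
      real (nedges D) + g \<le> m * real (nverts D)"
    using primal_gap[OF H(1)] unfolding m_def by blast
  \<comment> \<open>The term 1/2 gives p^m \<le> n^(-1/2), hence n^(g/(2m)) \<le> p^(-g); the other
    term gives \<omega>^k \<le> n^(\<beta> k) \<le> n^(g/(2m)).\<close>
  define \<beta> where "\<beta> = min (1/2) (g / (2 * m * real k))"
  have "real n * p powr m > 0 \<Longrightarrow> (real n * p powr m) powr real k \<le> real n ^ nverts D * p ^ nedges D"
    if p: "0 < p" "p \<le> 1" and n: "n \<ge> 1" and \<omega>: "1 \<le> real n * p powr m" "real n * p powr m \<le> real n powr \<beta>"
      and D: "subgraph D H" "nedges D \<ge> 1" for n p D
  proof -
    let ?\<omega> = "real n * p powr m"
    have vD: "nverts D \<ge> 1" by (rule subgraph_verts_pos[OF H(1) D])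
    have eq: "real n ^ nverts D * p ^ nedges D = ?\<omega> ^ nverts D * p powr (real (nedges D) - m * real (nverts D))"
    proof -
      have "p ^ nedges D = (p powr m) ^ nverts D * p powr (real (nedges D) - m * real (nverts D))"
        using p by (simp add: powr_powr flip: powr_realpow powr_add)
      then show ?thesis by (simp add: power_mult_distrib mult.assoc)
    qed
    show "?\<omega> powr real k \<le> real n ^ nverts D * p ^ nedges D"
    proof (cases "D \<in> primal H")
      case True
      have "?\<omega> powr real k = ?\<omega> ^ k" using \<omega> by (intro powr_realpow) linarith
      also have "\<dots> \<le> ?\<omega> ^ nverts D" by (rule power_increasing[OF k_le[OF True] \<omega>(1)])
      finally show ?thesis
        using True p unfolding eq by (simp add: primal_iff m_def)
    next
      case False
      have "p powr m = ?\<omega> / real n" using n by simp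
      also have "\<dots> \<le> real n powr \<beta> / real n" using \<omega> by (intro divide_right_mono) auto
      also have "\<dots> = real n powr (\<beta> - 1)" using n by (simp add: powr_diff)
      also have "\<dots> \<le> real n powr (- (1/2))" using n by (intro powr_mono) (auto simp: \<beta>_def)
      finally have pm: "p powr m \<le> real n powr (- (1/2))" .
      have "?\<omega> powr real k \<le> (real n powr \<beta>) powr real k"
        using \<omega> by (intro powr_mono2) auto
      also have "\<dots> = real n powr (\<beta> * real k)" by (simp add: powr_powr)
      also have "\<dots> \<le> real n powr (g / (2 * m))"
      proof (intro powr_mono)
        have "\<beta> * real k \<le> g / (2 * m * real k) * real k"
          by (intro mult_right_mono) (auto simp: \<beta>_def)
        then show "\<beta> * real k \<le> g / (2 * m)" using k by simp
      qed (use n in simp)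
      also have "\<dots> = (real n powr (- (1/2))) powr (- g / m)" by (simp add: powr_powr)
      also have "\<dots> \<le> (p powr m) powr (- g / m)"
        using pm p g(1) m by (intro powr_mono2') auto
      also have "\<dots> = p powr (- g)" using m by (simp add: powr_powr)
      also have "\<dots> \<le> p powr (real (nedges D) - m * real (nverts D))"
        using g(2)[OF D(1) vD False] p by (intro powr_mono') auto
      also have "\<dots> \<le> ?\<omega> ^ nverts D * p powr (real (nedges D) - m * real (nverts D))"
        using one_le_power[OF \<omega>(1), of "nverts D"]
          mult_right_mono[of 1 "?\<omega> ^ nverts D" "p powr (real (nedges D) - m * real (nverts D))"] by simp
      finally show ?thesis unfolding eq .
    qed
  qed
  moreover have "\<beta> > 0" using g(1) m k by (simp add: \<beta>_def)
  ultimately show ?thesis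
    unfolding m_def k_def by (intro exI[of _ \<beta>]) force
qed

lemma mu_subgraph_ge:
  assumes H: "simple_graph H" and D: "subgraph D H" "nedges D \<ge> 1" and p: "p \<in> {0..1}" and n: "nverts H \<le> n"
  shows "real n ^ nverts D * p ^ nedges D \<le> (2 * real (nverts H)) ^ nverts H * mu_copies D n p"
proof -
  have vD: "nverts D \<ge> 1" by (rule subgraph_verts_pos[OF H D])
  have le: "nverts D \<le> nverts H"
    using D(1) simple_graph_finite[OF H] by (intro card_mono) (auto simp: subgraph_def)
  have sD: "simple_graph D" using D by (simp add: subgraph_def)
  have "real n ^ nverts D * p ^ nedges D \<le> (2 * real (nverts D)) ^ nverts D * mu_copies D n p"
    using vD le n by (intro mu_copies_ge sD p) auto
  also have "\<dots> \<le> (2 * real (nverts H)) ^ nverts H * mu_copies D n p"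
  proof (rule mult_right_mono)
    have "(2 * real (nverts D)) ^ nverts D \<le> (2 * real (nverts H)) ^ nverts D"
      using le by (intro power_mono) auto
    also have "\<dots> \<le> (2 * real (nverts H)) ^ nverts H"
      using le vD by (intro power_increasing) auto
    finally show "(2 * real (nverts D)) ^ nverts D \<le> (2 * real (nverts H)) ^ nverts H" .
    show "0 \<le> mu_copies D n p" using mu_copies_eq[OF sD p] p by simp
  qed
  finally show ?thesis .
qed

lemma Phi_min_ge:
  assumes H: "simple_graph H" "nedges H \<ge> 1"
    and x: "\<And>D. subgraph D H \<Longrightarrow> nedges D \<ge> 1 \<Longrightarrow> x \<le> mu_copies D n p"
  shows "x \<le> Phi_min H n p"
proof -
  let ?S = "{G. subgraph G H \<and> nedges G \<ge> 1}"
  have "finite ?S" using finite_subgraphs[OF H(1)] by (rule rev_finite_subset) blast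
  moreover have "H \<in> ?S" using H by (simp add: subgraph_def)
  then have "?S \<noteq> {}" by blast
  ultimately show ?thesis
    unfolding Phi_min_def using x by (subst Min_ge_iff) auto
qed

text \<open>The zero function is feasible; the upper bound \<open>nverts G\<close> on all feasible
  sums makes the supremum an upper bound in HOL.\<close>

lemma frac_indep_number_nonneg:
  assumes "simple_graph G"
  shows "frac_indep_number G \<ge> 0"
  unfolding frac_indep_number_def
proof (rule cSup_upper)
  show "(0::real) \<in> {(\<Sum>v\<in>verts G. f v) | f :: 'a \<Rightarrow> real.
      (\<forall>v\<in>verts G. f v \<in> {0..1}) \<and> (\<forall>u v. {u, v} \<in> edges G \<longrightarrow> f u + f v \<le> 1)}"
    by (rule CollectI, rule exI[of _ "\<lambda>_. 0"]) simp
  show "bdd_above {(\<Sum>v\<in>verts G. f v) | f :: 'a \<Rightarrow> real.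
      (\<forall>v\<in>verts G. f v \<in> {0..1}) \<and> (\<forall>u v. {u, v} \<in> edges G \<longrightarrow> f u + f v \<le> 1)}"
  proof (rule bdd_aboveI[of _ "real (nverts G)"])
    fix x assume "x \<in> {(\<Sum>v\<in>verts G. f v) | f :: 'a \<Rightarrow> real.
      (\<forall>v\<in>verts G. f v \<in> {0..1}) \<and> (\<forall>u v. {u, v} \<in> edges G \<longrightarrow> f u + f v \<le> 1)}"
    then obtain f where "x = (\<Sum>v\<in>verts G. f v)" "\<forall>v\<in>verts G. f v \<in> {0..1::real}" by blast
    then show "x \<le> real (nverts G)"
      using sum_bounded_above[of "verts G" f 1] by simp
  qed
qed

text \<open>This crude bound is enough, because the factor log(1/p) is of order at least log n. In
  the second range p^\<Delta> \<ge> 1/n, so n^2 p^\<Delta> is even at least n.\<close>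

lemma M_tail_ge_1:
  assumes H: "simple_graph H" "nedges H \<ge> 1" and n: "n \<ge> 1" and p: "0 < p"
    and \<mu>: "\<And>D. subgraph D H \<Longrightarrow> nedges D \<ge> 1 \<Longrightarrow> 1 \<le> mu_copies D n p"
  shows "1 \<le> M_tail H n p"
proof (cases "p < real n powr (- 1 / real (max_degree H))")
  case True
  let ?S = "{G. subgraph G H \<and> nedges G \<ge> 1}"
  have "finite ?S" using finite_subgraphs[OF H(1)] by (rule rev_finite_subset) blast
  moreover have "H \<in> ?S" using H by (simp add: subgraph_def)
  then have "?S \<noteq> {}" by blast
  moreover have "1 \<le> mu_copies D n p powr (1 / frac_indep_number D)" if "D \<in> ?S" for D
    using \<mu>[of D] that frac_indep_number_nonneg[of D] by (intro ge_one_powr_ge_zero) (auto simp: subgraph_def)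
  ultimately show ?thesis
    unfolding M_tail_def if_P[OF True] by (subst Min_ge_iff) auto
next
  case False
  have "1 / real n \<le> p ^ max_degree H"
  proof (cases "max_degree H = 0")
    case False': False
    have "1 / real n = (real n powr (- 1 / real (max_degree H))) powr real (max_degree H)"
      using n False' unfolding powr_powr by (simp add: powr_minus_divide)
    also have "\<dots> \<le> p powr real (max_degree H)"
      using False n by (intro powr_mono2) auto
    finally show ?thesis using p by (simp add: powr_realpow)
  qed (use n in simp)
  then have "real n ^ 2 * (1 / real n) \<le> real n ^ 2 * p ^ max_degree H"
    by (intro mult_left_mono) auto
  then have "real n \<le> real n ^ 2 * p ^ max_degree H"
    using n by (simp add: power2_eq_square)
  then show ?thesis
    unfolding M_tail_def if_not_P[OF False] using n by simp
qed

section \<open>Upper tails\<close>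

lemma upper_tail_antimono: "x \<le> y \<Longrightarrow> upper_tail H n p y \<le> upper_tail H n p x"
  unfolding upper_tail_def by (intro measure_pmf.finite_measure_mono) auto

lemma neg_log_smalloI:
  assumes q: "\<forall>\<^sub>F n in sequentially. exp (- x n) \<le> q n" "\<And>n. q n \<le> 1"
    and x: "\<And>c. c > 0 \<Longrightarrow> \<forall>\<^sub>F n in sequentially. x n \<le> c * g n"
  shows "neg_log_smallo q g"
  unfolding neg_log_smallo_def
proof
  show "\<forall>\<^sub>F n in sequentially. q n > 0"
    using q(1) by eventually_elim (rule less_le_trans[OF exp_gt_zero])
  show "(\<lambda>n. - ln (q n)) \<in> o(g)"
  proof (rule landau_o.smallI)
    fix c :: real assume c: "c > 0"
    show "\<forall>\<^sub>F n in sequentially. norm (- ln (q n)) \<le> c * norm (g n)"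
      using q(1) x[OF c]
    proof eventually_elim
      case (elim n)
      have pos: "q n > 0" using elim(1) by (rule less_le_trans[OF exp_gt_zero])
      have "- x n \<le> ln (q n)" using elim(1) pos by (simp add: ln_ge_iff)
      moreover have "ln (q n) \<le> 0" using q(2)[of n] pos by simp
      moreover have "c * g n \<le> c * norm (g n)" using c by (intro mult_left_mono) auto
      ultimately show ?case using elim(2) by simp
    qed
  qed
qed

lemma powr_le_powr:
  fixes a b c :: real
  assumes "a < b" "0 < c"
  shows "eventually (\<lambda>x. x powr a \<le> c * x powr b) at_top"
  using assms by real_asymp

lemma ln_powr_le_powr:
  fixes b c :: real
  assumes "0 < b"
  shows "\<forall>\<^sub>F n::nat in sequentially. ln n powr c \<le> n powr b"
  using assms by real_asymp

lemma sqrt_ln_le_ln: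
  fixes c :: real
  assumes "0 < c"
  shows "\<forall>\<^sub>F n::nat in sequentially. sqrt (ln n) \<le> c * ln n"
  using assms by real_asymp

locale unstable = blowup H I U0 U "max_density H" for H :: "'a ugraph" and I :: "'i set" and U0 U +
  assumes edges_H: "nedges H \<ge> 1"
    and unstable: "real (card K) / real (card I) < real (Min (nverts ` primal H))"
begin

section \<open>Exponents and constants\<close>

definition vmin :: real where "vmin = real (Min (nverts ` primal H))"

definition \<kappa> :: real where "\<kappa> = real (card K) / real (card I)"

text \<open>The planted graph needs z of order \<omega>^\<kappa>, while the expected counts are at
  least of order \<omega>^vmin. The midpoint leaves room for the factor log z.\<close>

definition \<kappa>' :: real where "\<kappa>' = (\<kappa> + vmin) / 2"

text \<open>With this choice \<open>\<kappa>' = vmin - 4 * \<delta>\<close>, so that \<omega>^(vmin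
  - 2\<delta>), which bounds \<lambda>^2 from below up to a constant, still dominates
  \<omega>^\<kappa>'.\<close>

definition \<delta> :: real where "\<delta> = (vmin - \<kappa>) / 8"

definition C1 :: real where "C1 = (2 * real (nverts H)) ^ nverts H"

definition C2 :: real where "C2 = real (nverts H + 1) ^ nverts H * C1\<^sup>2"

lemma exponents: "0 < \<kappa>" "\<kappa> < \<kappa>'" "\<kappa>' < vmin" "0 < \<delta>" "\<kappa>' < vmin - 2 * \<delta>" "0 < vmin"
proof -
  have "card I > 0" "card K > 0"
    using I U(1) finite_sets(1) by (auto simp: card_gt_0_iff K_def)
  then have "0 < \<kappa>" by (simp add: \<kappa>_def)
  moreover have "\<kappa> < vmin" using unstable by (simp add: \<kappa>_def vmin_def)
  ultimately show "0 < \<kappa>" "\<kappa> < \<kappa>'" "\<kappa>' < vmin" "0 < \<delta>" "\<kappa>' < vmin - 2 * \<delta>" "0 < vmin"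
    unfolding \<kappa>'_def \<delta>_def by (simp_all add: field_simps)
qed

lemma nverts_pos: "nverts H \<ge> 1"
  using subgraph_verts_pos[OF H _ edges_H] H by (simp add: subgraph_def)

lemma constants_pos: "0 < C1" "0 < C2"
  using nverts_pos by (auto simp: C1_def C2_def)

text \<open>The common setting of both claims: a polylogarithmic bound on \<omega> implies the
  polynomial one.\<close>

definition admissible :: "real \<Rightarrow> (nat \<Rightarrow> real) \<Rightarrow> bool" where
  "admissible \<beta> p \<longleftrightarrow> (\<forall>n. p n \<in> {0..1}) \<and>
     filterlim (\<lambda>n. edge_scale n (p n)) at_top sequentially \<and>
     (\<forall>\<^sub>F n in sequentially. edge_scale n (p n) \<le> real n powr \<beta>)"

lemma admissibleI:
  assumes "\<forall>n. p n \<in> {0..1}" "(\<lambda>n. 1 :: real) \<in> o(\<lambda>n. edge_scale n (p n))"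
    and "\<forall>\<^sub>F n in sequentially. edge_scale n (p n) \<le> real n powr \<beta>"
  shows "admissible \<beta> p"
proof -
  have "filterlim (\<lambda>n. edge_scale n (p n)) at_top sequentially"
    unfolding filterlim_at_top
  proof
    fix Z :: real
    have "1 / max Z 1 > 0" by simp
    from landau_o.smallD[OF assms(2) this]
    show "\<forall>\<^sub>F n in sequentially. Z \<le> edge_scale n (p n)"
    proof eventually_elim
      case (elim n)
      have "edge_scale n (p n) \<ge> 0" by (simp add: edge_scale_def)
      then have "max Z 1 \<le> edge_scale n (p n)" using elim by (simp add: field_simps)
      then show ?case by simp
    qed
  qed
  then show ?thesis using assms by (simp add: admissible_def)
qed

text \<open>From \<omega> \<le> sqrt n one gets p^m \<le> n^(-1/2); taking logarithms yields the
  bound on log(1/p), and p < 1 follows from it.\<close>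

lemma eventually_basic:
  assumes "\<beta> \<le> 1/2" "admissible \<beta> p"
  shows "\<forall>\<^sub>F n in sequentially. n \<ge> 1 \<and> nverts H \<le> n \<and> 1 \<le> edge_scale n (p n) \<and> 0 < p n \<and> p n < 1 \<and>
    ln (real n) \<le> 2 * max_density H * ln (1 / p n)"
proof -
  have "\<forall>\<^sub>F n in sequentially. 1 \<le> edge_scale n (p n)"
    using assms(2) unfolding admissible_def filterlim_at_top by blast
  moreover have "\<forall>\<^sub>F n in sequentially. edge_scale n (p n) \<le> real n powr \<beta>"
    using assms(2) unfolding admissible_def by blast
  ultimately show ?thesis
    using eventually_ge_at_top[of "max 2 (nverts H)"]
  proof eventually_elim
    case (elim n)
    have n: "n \<ge> 2" "nverts H \<le> n" using elim(3) by simp_all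
    have "p n \<noteq> 0" using elim(1) by (auto simp: edge_scale_def)
    moreover have "p n \<in> {0..1}" using assms(2) by (simp add: admissible_def)
    ultimately have p: "0 < p n" by simp
    have "real n powr \<beta> \<le> real n powr (1/2)"
      by (rule powr_mono[OF assms(1)]) (use n in simp)
    then have "real n * p n powr max_density H \<le> real n powr (1/2)"
      using elim(2) unfolding edge_scale_def by linarith
    then have "ln (real n * p n powr max_density H) \<le> ln (real n powr (1/2))"
      using n p by (intro ln_mono) auto
    then have "ln (real n) + max_density H * ln (p n) \<le> ln (real n) / 2"
      using n p by (simp add: ln_mult ln_powr)
    then have 1: "ln (real n) \<le> 2 * max_density H * ln (1 / p n)"
      using p by (simp add: ln_div)
    have "ln (real n) > 0" using n by simp
    then have "0 < 2 * max_density H * ln (1 / p n)" using 1 by linarith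
    then have "ln (p n) < 0"
      using m p by (simp add: ln_div zero_less_mult_iff mult_less_0_iff)
    then have "p n < 1" using p by simp
    then show ?case using n p 1 elim(1) by simp
  qed
qed

lemma ex_beta:
  "\<exists>\<beta>>0. \<beta> \<le> 1/2 \<and> \<beta> \<le> 1 / (2 * real (nverts H)) \<and> (\<forall>n p D. 0 < p \<longrightarrow> p \<le> 1 \<longrightarrow> n \<ge> 1 \<longrightarrow>
    1 \<le> edge_scale n p \<longrightarrow> edge_scale n p \<le> real n powr \<beta> \<longrightarrow> subgraph D H \<longrightarrow> nedges D \<ge> 1 \<longrightarrow>
    edge_scale n p powr vmin \<le> real n ^ nverts D * p ^ nedges D)"
proof -
  obtain \<beta>0 where \<beta>0: "\<beta>0 > 0" "\<And>n p D. 0 < p \<Longrightarrow> p \<le> 1 \<Longrightarrow> n \<ge> 1 \<Longrightarrow>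
    1 \<le> edge_scale n p \<Longrightarrow> edge_scale n p \<le> real n powr \<beta>0 \<Longrightarrow> subgraph D H \<Longrightarrow> nedges D \<ge> 1 \<Longrightarrow>
    edge_scale n p powr vmin \<le> real n ^ nverts D * p ^ nedges D"
    using expected_embeddings_ge[OF H edges_H] unfolding edge_scale_def vmin_def by blast
  define \<beta> where "\<beta> = min \<beta>0 (min (1/2) (1 / (2 * real (nverts H))))"
  have "\<beta> > 0" using \<beta>0(1) nverts_pos by (simp add: \<beta>_def)
  moreover have "edge_scale n p powr vmin \<le> real n ^ nverts D * p ^ nedges D"
    if "0 < p" "p \<le> 1" "n \<ge> 1" "1 \<le> edge_scale n p" "edge_scale n p \<le> real n powr \<beta>" "subgraph D H" "nedges D \<ge> 1"
    for n p D
  proof (rule \<beta>0(2))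
    have "real n powr \<beta> \<le> real n powr \<beta>0" using that(3) by (intro powr_mono) (auto simp: \<beta>_def)
    then show "edge_scale n p \<le> real n powr \<beta>0" using that(5) by linarith
  qed (use that in auto)
  moreover have "\<beta> \<le> 1/2" "\<beta> \<le> 1 / (2 * real (nverts H))" by (auto simp: \<beta>_def)
  ultimately show ?thesis by blast
qed

text \<open>The exponent serves three ends: p is polynomially small, the planted graph fits into
  \<open>{1..n}\<close>, and no subgraph count falls below order \<omega>^vmin. Choosing it by
  \<open>SOME\<close> makes it a constant of the locale, fixed before p.\<close>

definition \<beta> :: real where
  "\<beta> = (SOME \<beta>. \<beta> > 0 \<and> \<beta> \<le> 1/2 \<and> \<beta> \<le> 1 / (2 * real (nverts H)) \<and> (\<forall>n p D. 0 < p \<longrightarrow> p \<le> 1 \<longrightarrow> n \<ge> 1 \<longrightarrow>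
    1 \<le> edge_scale n p \<longrightarrow> edge_scale n p \<le> real n powr \<beta> \<longrightarrow> subgraph D H \<longrightarrow> nedges D \<ge> 1 \<longrightarrow>
    edge_scale n p powr vmin \<le> real n ^ nverts D * p ^ nedges D))"

lemma \<beta>: "\<beta> > 0" "\<beta> \<le> 1/2" "\<beta> \<le> 1 / (2 * real (nverts H))"
  "0 < p \<Longrightarrow> p \<le> 1 \<Longrightarrow> n \<ge> 1 \<Longrightarrow> 1 \<le> edge_scale n p \<Longrightarrow> edge_scale n p \<le> real n powr \<beta> \<Longrightarrow>
    subgraph D H \<Longrightarrow> nedges D \<ge> 1 \<Longrightarrow> edge_scale n p powr vmin \<le> real n ^ nverts D * p ^ nedges D"
proof -
  note * = someI_ex[OF ex_beta, folded \<beta>_def]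
  show "\<beta> > 0" "\<beta> \<le> 1/2" "\<beta> \<le> 1 / (2 * real (nverts H))" using * by blast+
  show "0 < p \<Longrightarrow> p \<le> 1 \<Longrightarrow> n \<ge> 1 \<Longrightarrow> 1 \<le> edge_scale n p \<Longrightarrow> edge_scale n p \<le> real n powr \<beta> \<Longrightarrow>
    subgraph D H \<Longrightarrow> nedges D \<ge> 1 \<Longrightarrow> edge_scale n p powr vmin \<le> real n ^ nverts D * p ^ nedges D"
    using * by blast
qed

lemma eventually_tail:
  assumes "admissible \<beta> p" "0 \<le> A"
  shows "\<forall>\<^sub>F n in sequentially. exp (- (edge_scale n (p n) powr \<kappa>')) \<le> upper_tail H n (p n) (A * mu_copies H n (p n))"
proof (rule eventually_upper_tail_ge)
  have "\<forall>\<^sub>F n in sequentially. edge_scale n (p n) \<le> real n powr \<beta>"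
    using assms(1) by (simp add: admissible_def)
  then show "\<forall>\<^sub>F n in sequentially. edge_scale n (p n) \<le> real n powr (1 / (2 * real (nverts H)))"
    using eventually_ge_at_top[of 1]
  proof eventually_elim
    case (elim n)
    have "real n powr \<beta> \<le> real n powr (1 / (2 * real (nverts H)))"
      using elim(2) \<beta>(3) by (intro powr_mono) auto
    then show ?case using elim(1) by linarith
  qed
  show "real (card K) / real (card I) < \<kappa>'" using exponents(2) by (simp add: \<kappa>_def)
qed (use assms in \<open>auto simp: admissible_def\<close>)

section \<open>Expected counts along an admissible sequence\<close>

lemma eventually_mu_subgraph:
  assumes "admissible \<beta> p"
  shows "\<forall>\<^sub>F n in sequentially. \<forall>D. subgraph D H \<longrightarrow> nedges D \<ge> 1 \<longrightarrow>
    edge_scale n (p n) powr vmin \<le> real n ^ nverts D * p n ^ nedges D \<and>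
    edge_scale n (p n) powr vmin / C1 \<le> mu_copies D n (p n)"
proof -
  have "\<forall>\<^sub>F n in sequentially. edge_scale n (p n) \<le> real n powr \<beta>"
    using assms by (simp add: admissible_def)
  then show ?thesis
    using eventually_basic[OF \<beta>(2) assms]
  proof eventually_elim
    case (elim n)
    show ?case
    proof (intro allI impI conjI)
      fix D assume D: "subgraph D H" "nedges D \<ge> 1"
      show 1: "edge_scale n (p n) powr vmin \<le> real n ^ nverts D * p n ^ nedges D"
        using elim D by (intro \<beta>(4)) auto
      have "real n ^ nverts D * p n ^ nedges D \<le> C1 * mu_copies D n (p n)"
        unfolding C1_def using elim by (intro mu_subgraph_ge H D) auto
      then show "edge_scale n (p n) powr vmin / C1 \<le> mu_copies D n (p n)"
        using 1 constants_pos by (simp add: pos_divide_le_eq mult.commute)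
    qed
  qed
qed

lemma eventually_scale:
  assumes "admissible \<beta> p" "eventually P at_top"
  shows "\<forall>\<^sub>F n in sequentially. P (edge_scale n (p n))"
  using assms eventually_compose_filterlim unfolding admissible_def by blast

text \<open>The cost \<omega>^\<kappa>' is compared with both terms of the minimum. It is negligible
  against \<open>Phi_min\<close> because \<kappa>' < vmin. It is at most sqrt(log n) by the bound on
  \<omega>, hence negligible against log(1/p), and \<open>M_tail\<close> is at least 1.\<close>

lemma upper_tail_mean:
  assumes p: "admissible \<beta> p"
    and \<omega>: "\<forall>\<^sub>F n in sequentially. edge_scale n (p n) \<le> ln (real n) powr (1 / (2 * \<kappa>'))"
    and \<epsilon>: "\<epsilon> > 0"
  shows "neg_log_smallo (\<lambda>n. upper_tail H n (p n) ((1 + \<epsilon>) * mu_copies H n (p n)))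
    (\<lambda>n. min (Phi_min H n (p n)) (M_tail H n (p n) * ln (1 / p n)))"
proof (rule neg_log_smalloI[where x = "\<lambda>n. edge_scale n (p n) powr \<kappa>'"])
  show "\<forall>\<^sub>F n in sequentially. exp (- (edge_scale n (p n) powr \<kappa>'))
      \<le> upper_tail H n (p n) ((1 + \<epsilon>) * mu_copies H n (p n))"
    using \<epsilon> by (intro eventually_tail p) auto
  show "upper_tail H n (p n) ((1 + \<epsilon>) * mu_copies H n (p n)) \<le> 1" for n
    by (simp add: upper_tail_def)
  fix c :: real assume c: "c > 0"
  have k': "\<kappa>' > 0" using exponents by linarith
  have ev1: "\<forall>\<^sub>F n in sequentially. edge_scale n (p n) powr \<kappa>' \<le> c / C1 * edge_scale n (p n) powr vmin"
    using c constants_pos exponents by (intro eventually_scale[OF p] powr_le_powr) auto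
  have ev2: "\<forall>\<^sub>F n in sequentially. edge_scale n (p n) powr 0 \<le> 1 / C1 * edge_scale n (p n) powr vmin"
    using constants_pos exponents by (intro eventually_scale[OF p] powr_le_powr) auto
  have ev3: "\<forall>\<^sub>F n::nat in sequentially. sqrt (ln n) \<le> c / (2 * max_density H) * ln n"
    using c m by (intro sqrt_ln_le_ln) auto
  show "\<forall>\<^sub>F n in sequentially. edge_scale n (p n) powr \<kappa>'
      \<le> c * min (Phi_min H n (p n)) (M_tail H n (p n) * ln (1 / p n))"
    using ev1 ev2 ev3 \<omega> eventually_basic[OF \<beta>(2) p] eventually_mu_subgraph[OF p]
  proof eventually_elim
    case (elim n)
    let ?\<omega> = "edge_scale n (p n)"
    have \<mu>: "?\<omega> powr vmin / C1 \<le> mu_copies D n (p n)" if "subgraph D H" "nedges D \<ge> 1" for D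
      using elim(6) that by blast
    have "?\<omega> powr vmin / C1 \<le> Phi_min H n (p n)"
      by (rule Phi_min_ge[OF H edges_H \<mu>])
    then have "c * (?\<omega> powr vmin / C1) \<le> c * Phi_min H n (p n)"
      using c by (intro mult_left_mono) auto
    then have 1: "?\<omega> powr \<kappa>' \<le> c * Phi_min H n (p n)" using elim(1) by simp
    have "1 \<le> mu_copies D n (p n)" if "subgraph D H" "nedges D \<ge> 1" for D
      using \<mu>[OF that] elim(2,5) by (simp add: edge_scale_def split: if_splits)
    then have M: "1 \<le> M_tail H n (p n)"
      using elim(5) by (intro M_tail_ge_1 H edges_H) auto
    have L: "ln (1 / p n) \<ge> 0" using elim(5) by (intro ln_ge_zero) auto
    have "?\<omega> powr \<kappa>' \<le> (ln (real n) powr (1 / (2 * \<kappa>'))) powr \<kappa>'"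
      using elim(4,5) k' by (intro powr_mono2) auto
    also have "\<dots> = ln (real n) powr (1/2)" using k' by (simp add: powr_powr)
    also have "\<dots> = sqrt (ln (real n))" using elim(5) by (intro powr_half_sqrt ln_ge_zero) auto
    also have "\<dots> \<le> c / (2 * max_density H) * ln (real n)" using elim(3) by simp
    also have "\<dots> \<le> c / (2 * max_density H) * (2 * max_density H * ln (1 / p n))"
      using elim(5) c m by (intro mult_left_mono) auto
    also have "\<dots> = c * (1 * ln (1 / p n))" using m by simp
    also have "\<dots> \<le> c * (M_tail H n (p n) * ln (1 / p n))"
      using M L c by (intro mult_left_mono mult_right_mono) auto
    finally have "?\<omega> powr \<kappa>' \<le> c * (M_tail H n (p n) * ln (1 / p n))" .
    then show ?case using 1 by (simp add: min_def)
  qed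
qed

text \<open>The factor \<omega>^(-\<delta>) puts \<lambda>\<sigma> just below \<mu>, so that
  \<lambda>\<sigma> = o(\<mu>), and lowers \<lambda>^2 only by \<omega>^(-2\<delta>).\<close>

definition lam :: "nat \<Rightarrow> real \<Rightarrow> real" where
  "lam n p = mu_copies H n p / sigma_copies H n p * edge_scale n p powr (- \<delta>)"

text \<open>\<open>variance_le\<close> applies with \<Phi> = \<omega>^vmin, and n^v p^e is at most
  C1 \<mu>; together they give \<mu>^2/\<sigma>^2 \<ge> \<omega>^vmin/C2.\<close>

lemma eventually_lam:
  assumes p: "admissible \<beta> p"
  shows "\<forall>\<^sub>F n in sequentially. 0 < sigma_copies H n (p n) \<and> 0 < mu_copies H n (p n) \<and>
    edge_scale n (p n) powr (vmin - 2 * \<delta>) \<le> C2 * (lam n (p n))\<^sup>2"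
  using eventually_basic[OF \<beta>(2) p] eventually_mu_subgraph[OF p]
proof eventually_elim
  case (elim n)
  let ?\<omega> = "edge_scale n (p n)" and ?\<mu> = "mu_copies H n (p n)" and ?\<sigma> = "sigma_copies H n (p n)"
  have \<omega>: "?\<omega> powr vmin > 0" using elim(1) by simp
  have HH: "subgraph H H" using H by (simp add: subgraph_def)
  have "?\<omega> powr vmin / C1 \<le> ?\<mu>" using elim(2) HH edges_H by blast
  moreover have "?\<omega> powr vmin / C1 > 0" using \<omega> constants_pos by simp
  ultimately have \<mu>: "?\<mu> > 0" by linarith
  have \<sigma>: "?\<sigma> > 0"
    using elim(1) \<mu> by (intro sigma_copies_pos H edges_H) auto
  have "?\<sigma>\<^sup>2 \<le> real (nverts H + 1) ^ nverts H * (real n ^ nverts H * p n ^ nedges H)\<^sup>2 / ?\<omega> powr vmin"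
    using elim \<omega> by (intro variance_le H) auto
  also have "\<dots> \<le> real (nverts H + 1) ^ nverts H * (C1 * ?\<mu>)\<^sup>2 / ?\<omega> powr vmin"
    unfolding C1_def using elim(1) \<omega>
    by (intro divide_right_mono mult_left_mono power_mono mu_subgraph_ge H HH edges_H) auto
  also have "\<dots> = C2 * ?\<mu>\<^sup>2 / ?\<omega> powr vmin"
    by (simp add: C2_def power_mult_distrib)
  finally have "?\<omega> powr vmin \<le> C2 * (?\<mu> / ?\<sigma>)\<^sup>2"
    using \<omega> \<sigma> by (simp add: field_simps power_divide)
  then have "?\<omega> powr vmin * ?\<omega> powr (- 2 * \<delta>) \<le> C2 * (?\<mu> / ?\<sigma>)\<^sup>2 * ?\<omega> powr (- 2 * \<delta>)"
    by (intro mult_right_mono) auto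
  moreover have "?\<omega> powr vmin * ?\<omega> powr (- 2 * \<delta>) = ?\<omega> powr (vmin - 2 * \<delta>)"
    by (simp flip: powr_add)
  moreover have "(?\<omega> powr (- \<delta>))\<^sup>2 = ?\<omega> powr (- 2 * \<delta>)"
    by (simp add: power2_eq_square flip: powr_add)
  ultimately have "?\<omega> powr (vmin - 2 * \<delta>) \<le> C2 * (lam n (p n))\<^sup>2"
    unfolding lam_def power_mult_distrib by (simp only: mult.assoc)
  then show ?case using \<sigma> \<mu> by blast
qed

lemma lam_at_top:
  assumes p: "admissible \<beta> p"
  shows "filterlim (\<lambda>n. lam n (p n)) at_top sequentially"
  unfolding filterlim_at_top
proof
  fix Z :: real
  \<comment> \<open>The exponent 0 stands for the constant 1, in the form that
    \<open>powr_le_powr\<close> compares with a positive power.\<close>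
  have "\<forall>\<^sub>F n in sequentially. edge_scale n (p n) powr 0
      \<le> 1 / (C2 * (max Z 1)\<^sup>2) * edge_scale n (p n) powr (vmin - 2 * \<delta>)"
    using constants_pos exponents by (intro eventually_scale[OF p] powr_le_powr) auto
  then show "\<forall>\<^sub>F n in sequentially. Z \<le> lam n (p n)"
    using eventually_lam[OF p] eventually_basic[OF \<beta>(2) p]
  proof eventually_elim
    case (elim n)
    have pos: "C2 * (max Z 1)\<^sup>2 > 0" using constants_pos by simp
    have "edge_scale n (p n) powr 0 = 1" using elim(3) by simp
    then have "C2 * (max Z 1)\<^sup>2 \<le> edge_scale n (p n) powr (vmin - 2 * \<delta>)"
      using elim(1) pos by (simp only: mult_1 times_divide_eq_left pos_le_divide_eq)
    also have "\<dots> \<le> C2 * (lam n (p n))\<^sup>2" using elim(2) by blast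
    finally have "(max Z 1)\<^sup>2 \<le> (lam n (p n))\<^sup>2" using constants_pos by simp
    moreover have "0 \<le> lam n (p n)" using elim(2) by (auto simp: lam_def)
    ultimately have "max Z 1 \<le> lam n (p n)" by (rule power2_le_imp_le)
    then show ?case by simp
  qed
qed

lemma lam_sigma_smallo:
  assumes p: "admissible \<beta> p"
  shows "(\<lambda>n. lam n (p n) * sigma_copies H n (p n)) \<in> o(\<lambda>n. mu_copies H n (p n))"
proof (rule landau_o.smallI)
  fix c :: real assume c: "c > 0"
  have "\<forall>\<^sub>F n in sequentially. edge_scale n (p n) powr (- \<delta>) \<le> c * edge_scale n (p n) powr 0"
    using c exponents by (intro eventually_scale[OF p] powr_le_powr) auto
  then show "\<forall>\<^sub>F n in sequentially. norm (lam n (p n) * sigma_copies H n (p n)) \<le> c * norm (mu_copies H n (p n))"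
    using eventually_lam[OF p] eventually_basic[OF \<beta>(2) p]
  proof eventually_elim
    case (elim n)
    have "lam n (p n) * sigma_copies H n (p n) = mu_copies H n (p n) * edge_scale n (p n) powr (- \<delta>)"
      using elim(2) by (simp add: lam_def)
    moreover have "edge_scale n (p n) powr (- \<delta>) \<le> c" using elim(1,3) by (simp split: if_splits)
    then have "mu_copies H n (p n) * edge_scale n (p n) powr (- \<delta>) \<le> mu_copies H n (p n) * c"
      using elim(2) by (intro mult_left_mono) auto
    ultimately show ?case using elim(2) by (simp add: mult.commute)
  qed
qed

text \<open>As t \<le> C \<mu>, it suffices to multiply the count by 1 + C, at cost
  \<omega>^\<kappa>'. As t \<ge> \<lambda>\<sigma>, the target t^2/\<sigma>^2 is at least
  \<lambda>^2, hence at least \<omega>^(vmin - 2\<delta>)/C2.\<close>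

lemma upper_tail_deviation:
  assumes p: "admissible \<beta> p"
    and t: "\<forall>\<^sub>F n in sequentially. lam n (p n) * sigma_copies H n (p n) \<le> t n"
      "t \<in> O(\<lambda>n. mu_copies H n (p n))"
  shows "neg_log_smallo (\<lambda>n. upper_tail H n (p n) (mu_copies H n (p n) + t n))
    (\<lambda>n. (t n)\<^sup>2 / (sigma_copies H n (p n))\<^sup>2)"
proof (rule neg_log_smalloI[where x = "\<lambda>n. edge_scale n (p n) powr \<kappa>'"])
  obtain C where C: "C > 0" "\<forall>\<^sub>F n in sequentially. norm (t n) \<le> C * norm (mu_copies H n (p n))"
    using t(2) by (elim landau_o.bigE)
  have "\<forall>\<^sub>F n in sequentially. exp (- (edge_scale n (p n) powr \<kappa>'))
      \<le> upper_tail H n (p n) ((1 + C) * mu_copies H n (p n))"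
    using C(1) by (intro eventually_tail p) auto
  then show "\<forall>\<^sub>F n in sequentially. exp (- (edge_scale n (p n) powr \<kappa>'))
      \<le> upper_tail H n (p n) (mu_copies H n (p n) + t n)"
    using C(2) eventually_lam[OF p]
  proof eventually_elim
    case (elim n)
    have "mu_copies H n (p n) + t n \<le> (1 + C) * mu_copies H n (p n)"
      using elim(2,3) by (simp add: algebra_simps)
    from upper_tail_antimono[OF this, of H n "p n"] show ?case using elim(1) by linarith
  qed
  show "upper_tail H n (p n) (mu_copies H n (p n) + t n) \<le> 1" for n
    by (simp add: upper_tail_def)
  fix c :: real assume c: "c > 0"
  have "\<forall>\<^sub>F n in sequentially. edge_scale n (p n) powr \<kappa>' \<le> c / C2 * edge_scale n (p n) powr (vmin - 2 * \<delta>)"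
    using c constants_pos exponents by (intro eventually_scale[OF p] powr_le_powr) auto
  then show "\<forall>\<^sub>F n in sequentially. edge_scale n (p n) powr \<kappa>' \<le> c * ((t n)\<^sup>2 / (sigma_copies H n (p n))\<^sup>2)"
    using t(1) eventually_lam[OF p]
  proof eventually_elim
    case (elim n)
    have pos: "0 < sigma_copies H n (p n)" "0 \<le> lam n (p n)"
      using elim(3) by (auto simp: lam_def)
    have "lam n (p n) \<le> t n / sigma_copies H n (p n)"
      using elim(2) pos by (simp add: pos_le_divide_eq)
    then have "(lam n (p n))\<^sup>2 \<le> (t n / sigma_copies H n (p n))\<^sup>2"
      using pos(2) by (rule power_mono)
    then have le: "c * (lam n (p n))\<^sup>2 \<le> c * ((t n)\<^sup>2 / (sigma_copies H n (p n))\<^sup>2)"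
      using c by (simp only: power_divide mult_le_cancel_left_pos)
    have "c / C2 * edge_scale n (p n) powr (vmin - 2 * \<delta>) \<le> c / C2 * (C2 * (lam n (p n))\<^sup>2)"
      using elim(3) c constants_pos by (intro mult_left_mono) auto
    also have "\<dots> = c * (lam n (p n))\<^sup>2" using constants_pos by simp
    finally show ?case using elim(1) le by linarith
  qed
qed

end

theorem theorem4:
  fixes H :: "'a ugraph"
  assumes "simple_graph H" and "nedges H \<ge> 1"
    and "\<exists>G\<in>primal H. \<exists>(r::nat)\<ge>1. \<exists>J :: nat \<Rightarrow> 'a ugraph.
           inj_on J {1..r} \<and> (\<forall>i\<in>{1..r}. J i \<in> primal H \<and> covers H (J i) G) \<and>
           real (nverts (graph_Union (J ` {1..r}))) / real r < real (Min (nverts ` primal H))"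
  shows "\<exists>(c::real)>0. \<exists>(\<beta>::real)>0.
    (\<forall>(\<epsilon>::real)>0. \<forall>p :: nat \<Rightarrow> real.
       (\<forall>n. p n \<in> {0..1}) \<longrightarrow>
       (\<lambda>n. 1 :: real) \<in> o(\<lambda>n. real n * p n powr max_density H) \<longrightarrow>
       (\<lambda>n. real n * p n powr max_density H) \<in> o(\<lambda>n. ln (real n) powr c) \<longrightarrow>
       neg_log_smallo (\<lambda>n. upper_tail H n (p n) ((1 + \<epsilon>) * mu_copies H n (p n)))
                      (\<lambda>n. min (Phi_min H n (p n)) (M_tail H n (p n) * ln (1 / p n)))) \<and>
    (\<exists>lam :: nat \<Rightarrow> real \<Rightarrow> real. \<forall>p :: nat \<Rightarrow> real.
       (\<forall>n. p n \<in> {0..1}) \<longrightarrow>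
       (\<lambda>n. 1 :: real) \<in> o(\<lambda>n. real n * p n powr max_density H) \<longrightarrow>
       (\<lambda>n. real n * p n powr max_density H) \<in> o(\<lambda>n. real n powr \<beta>) \<longrightarrow>
       filterlim (\<lambda>n. lam n (p n)) at_top sequentially \<and>
       (\<lambda>n. lam n (p n) * sigma_copies H n (p n)) \<in> o(\<lambda>n. mu_copies H n (p n)) \<and>
       (\<forall>t :: nat \<Rightarrow> real.
          (\<forall>\<^sub>F n in sequentially. lam n (p n) * sigma_copies H n (p n) \<le> t n) \<longrightarrow>
          t \<in> O(\<lambda>n. mu_copies H n (p n)) \<longrightarrow>
          neg_log_smallo (\<lambda>n. upper_tail H n (p n) (mu_copies H n (p n) + t n))
                         (\<lambda>n. (t n)\<^sup>2 / (sigma_copies H n (p n))\<^sup>2)))"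
proof -
  obtain G r J where G: "G \<in> primal H" and r: "(r::nat) \<ge> 1" and inj: "inj_on J {1..r}"
    and J: "\<forall>i\<in>{1..r}. J i \<in> primal H \<and> covers H (J i) G"
    and K_less: "real (nverts (graph_Union (J ` {1..r}))) / real r < real (Min (nverts ` primal H))"
    using assms(3) by blast
  have "{1..r} \<noteq> {}" using r by simp
  then interpret blowup H "{1..r}" "verts G" "\<lambda>i. verts (J i)" "max_density H"
    using J by (intro covers_blowup assms(1,2) G inj) auto
  interpret unstable H "{1..r}" "verts G" "\<lambda>i. verts (J i)"
  proof
    have "verts (graph_Union (J ` {1..r})) = K" unfolding K_def graph_Union_def by simp
    then show "real (card K) / real (card {1..r}) < real (Min (nverts ` primal H))"
      using K_less by simp
  qed (rule assms(2))
  have scale: "real n * x powr max_density H = edge_scale n x" for n x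
    by (simp add: edge_scale_def)
  \<comment> \<open>With this exponent, \<omega> \<le> (log n)^c means \<omega>^\<kappa>' \<le>
    sqrt(log n).\<close>
  define c where "c = 1 / (2 * \<kappa>')"
  have c: "c > 0" using exponents by (simp add: c_def)
  have le: "\<forall>\<^sub>F n in sequentially. f n \<le> g n"
    if "f \<in> o(g)" "\<And>n. g n \<ge> 0" for f g :: "nat \<Rightarrow> real"
    using landau_o.smallD[OF that(1) zero_less_one]
  proof eventually_elim
    case (elim n)
    then show ?case using that(2)[of n] by simp
  qed
  show ?thesis
    unfolding scale
  proof (rule exI[of _ c], rule conjI[OF c], rule exI[of _ \<beta>], rule conjI[OF \<beta>(1)],
      intro conjI exI[of _ lam] allI impI)
    fix \<epsilon> :: real and p :: "nat \<Rightarrow> real"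
    assume \<epsilon>: "\<epsilon> > 0" and p: "\<forall>n. p n \<in> {0..1}" "(\<lambda>n. 1) \<in> o(\<lambda>n. edge_scale n (p n))"
      and \<omega>: "(\<lambda>n. edge_scale n (p n)) \<in> o(\<lambda>n. ln (real n) powr c)"
    have \<omega>_le: "\<forall>\<^sub>F n in sequentially. edge_scale n (p n) \<le> ln (real n) powr c"
      by (rule le[OF \<omega>]) simp
    then have "\<forall>\<^sub>F n in sequentially. edge_scale n (p n) \<le> real n powr \<beta>"
      using ln_powr_le_powr[OF \<beta>(1), of c] by eventually_elim simp
    then have "admissible \<beta> p" by (rule admissibleI[OF p])
    then show "neg_log_smallo (\<lambda>n. upper_tail H n (p n) ((1 + \<epsilon>) * mu_copies H n (p n)))
        (\<lambda>n. min (Phi_min H n (p n)) (M_tail H n (p n) * ln (1 / p n)))"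
      using \<omega>_le \<epsilon> unfolding c_def by (rule upper_tail_mean)
  next
    fix p :: "nat \<Rightarrow> real"
    assume p: "\<forall>n. p n \<in> {0..1}" "(\<lambda>n. 1) \<in> o(\<lambda>n. edge_scale n (p n))"
      and \<omega>: "(\<lambda>n. edge_scale n (p n)) \<in> o(\<lambda>n. real n powr \<beta>)"
    have adm: "admissible \<beta> p" by (rule admissibleI[OF p le[OF \<omega>]]) simp
    show "filterlim (\<lambda>n. lam n (p n)) at_top sequentially" by (rule lam_at_top[OF adm])
    show "(\<lambda>n. lam n (p n) * sigma_copies H n (p n)) \<in> o(\<lambda>n. mu_copies H n (p n))"
      by (rule lam_sigma_smallo[OF adm])
    fix t assume "\<forall>\<^sub>F n in sequentially. lam n (p n) * sigma_copies H n (p n) \<le> t n"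
      "t \<in> O(\<lambda>n. mu_copies H n (p n))"
    then show "neg_log_smallo (\<lambda>n. upper_tail H n (p n) (mu_copies H n (p n) + t n))
        (\<lambda>n. (t n)\<^sup>2 / (sigma_copies H n (p n))\<^sup>2)"
      by (rule upper_tail_deviation[OF adm])
  qed
qed

end
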